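(* Let $A$ be a Hirsch algebra. Then the set $TS(A)$ of twisting sequences in $A$ has an explicit unital product $\mu:TS(A)\times TS(A)\to TS(A)$ (given by the formula in the context), which is natural for Hirsch algebra maps. Writing $ts(A)$ for the set of homotopy classes of twisting sequences, this descends to a product $h\mu:ts(A)\times ts(A)\to ts(A)$.
   Context: All dg-algebras are associative, $\mathbb Z$-graded, with differential of degree $+1$ satisfying $d(ab)=(da)b+(-1)^{|a|}a(db)$, are free as $\mathbb Z$-modules and have finitely generated cohomology in each degree. A Hirsch algebra is a dg-algebra $A$ with maps $E_{p,q}:A^{\otimes p}\otimes A^{\otimes q}\to A$ of degree $1-p-q$ for $p,q\ge0$, $p+q\ge1$, such that $E_{1,0}=E_{0,1}=\mathrm{Id}$, $E_{0,p}=E_{p,0}=0$ for $p>1$, and \begin{align*} dE_{p,q}(a_1,\dots,a_p;b_1,\dots,b_q)&=\sum_{1\le i\le p}(-1)^{\epsilon^a_{i-1}}E_{p,q}(a_1,\dots,da_i,\dots,a_p;b_1,\dots,b_q)\\ &+\sum_{1\le j\le q}(-1)^{\epsilon^a_p+\epsilon^b_{j-1}}E_{p,q}(a_1,\dots,a_p;b_1,\dots,db_j,\dots,b_q)\\ &+\sum_{1\le i<p}(-1)^{\epsilon^a_i}E_{p-1,q}(a_1,\dots,a_ia_{i+1},\dots,a_p;b_1,\dots,b_q)\\ &+\sum_{1\le j<q}(-1)^{\epsilon^a_p+\epsilon^b_j}E_{p,q-1}(a_1,\dots,a_p;b_1,\dots,b_jb_{j+1},\dots,b_q)\\ &+\sum_{(i,j)}(-1)^{\epsilon_{i,j}}E_{i,j}(a_1,\dots,a_i;b_1,\dots,b_j)\cdot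 E_{p-i,q-j}(a_{i+1},\dots,a_p;b_{j+1},\dots,b_q), \end{align*} where the last sum is over $0\le i\le p$, $0\le j\le q$ with $(i,j)\ne(0,0),(p,q)$; $\epsilon^x_i=|x_1|+\dots+|x_i|+i$ and $\epsilon_{i,j}=\epsilon^a_i+\epsilon^b_j+(\epsilon^a_i+\epsilon^a_p)\epsilon^b_j+1$. A Hirsch algebra map is a dg-algebra map commuting with all $E_{p,q}$. A twisting sequence in $A$ is a sequence $x_\bullet=(x_3,x_5,\dots)$ with $x_{2n+1}\in A^{2n+1}$ and $dx_{2n+1}+\sum_{i+j=n,\ i,j\ge1}x_{2i+1}x_{2j+1}=0$ for all $n\ge1$. Two twisting sequences $x_\bullet,y_\bullet$ are homotopic if there are $h_{2n}\in A^{2n}$ ($n\ge1$) with $y_{2n+1}-x_{2n+1}+dh_{2n}+\sum_{i+j=n,\ i,j\ge1}(y_{2j+1}h_{2i}-h_{2i}x_{2j+1})=0$ for all $n\ge1$ (this is an equivalence relation). The explicit product is $$\mu(x_\bullet,y_\bullet)_{2k+1}=\sum E_{m,n}(x_{2i_1+1},\dots,x_{2i_m+1};y_{2j_1+1},\dots,y_{2j_n+1}),$$ summed over $m,n\ge0$ with $(m,n)\neq(0,0)$ and $i_1,\dots,i_m,j_1,\dots,j_n\ge1$ with $i_1+\dots+i_m+j_1+\dots+j_n=k$. The unit is the zero sequence. *)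

theory Defs
  imports
    "HOL-Algebra.Free_Abelian_Groups"
    "HOL-Computational_Algebra.Formal_Power_Series"
begin

section \<open>Dg-algebras\<close>

text \<open>
  A dg-algebra is carried by the total module \<open>\<Oplus>\<^sub>n A\<^sup>n\<close>, which is a type of class
  \<open>ring\<close> (associative, no unit required); \<open>grading A n\<close> is the summand \<open>A\<^sup>n\<close>.
\<close>

record 'a dg_alg =
  grading :: "int \<Rightarrow> 'a set"
  diff :: "'a \<Rightarrow> 'a"

definition additive_group :: "'a::ab_group_add set \<Rightarrow> 'a monoid" where
  "additive_group S = \<lparr>carrier = S, monoid.mult = (+), one = 0\<rparr>"

definition sgn_pow :: "int \<Rightarrow> 'a::ab_group_add \<Rightarrow> 'a" where
  \<comment> \<open>\<open>(-1)\<^sup>n a\<close>\<close>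
  "sgn_pow n a = (if even n then a else - a)"

definition cocycles :: "('a::ring, 'm) dg_alg_scheme \<Rightarrow> int \<Rightarrow> 'a set" where
  "cocycles A n = {a \<in> grading A n. diff A a = 0}"

definition coboundaries :: "('a::ring, 'm) dg_alg_scheme \<Rightarrow> int \<Rightarrow> 'a set" where
  "coboundaries A n = diff A ` grading A (n - 1)"

definition cohomology :: "('a::ring, 'm) dg_alg_scheme \<Rightarrow> int \<Rightarrow> 'a set monoid" where
  "cohomology A n = additive_group (cocycles A n) Mod coboundaries A n"

definition finitely_generated_group :: "('a, 'b) monoid_scheme \<Rightarrow> bool" where
  "finitely_generated_group G \<longleftrightarrow>
     (\<exists>S. finite S \<and> S \<subseteq> carrier G \<and> generate G S = carrier G)"

locale dg_algebra =
  fixes A :: "('a::ring, 'm) dg_alg_scheme"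
  assumes grading_subgroup: "subgroup (grading A n) (additive_group UNIV)"
    and direct_sum:
      "\<exists>!c. finite {n. c n \<noteq> 0} \<and> (\<forall>n. c n \<in> grading A n) \<and> a = (\<Sum>n | c n \<noteq> 0. c n)"
    and mult_grading: "a \<in> grading A m \<Longrightarrow> b \<in> grading A n \<Longrightarrow> a * b \<in> grading A (m + n)"
    and diff_additive: "additive (diff A)"
    and diff_grading: "a \<in> grading A n \<Longrightarrow> diff A a \<in> grading A (n + 1)"
    and diff_diff: "diff A (diff A a) = 0"
    and Leibniz: "a \<in> grading A n \<Longrightarrow> diff A (a * b) = diff A a * b + sgn_pow n (a * diff A b)"
    and free: "\<exists>S :: 'a set. additive_group (UNIV :: 'a set) \<cong> free_Abelian_group S"
    and fin_gen_cohomology: "finitely_generated_group (cohomology A n)"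


section \<open>Hirsch algebras\<close>

text \<open>
  The maps \<open>E\<^sub>p\<^sub>,\<^sub>q\<close> are bundled into one function on pairs of lists: for \<open>length as = p\<close> and
  \<open>length bs = q\<close>, the value of \<open>E\<^sub>p\<^sub>,\<^sub>q\<close> is \<open>hop A as bs\<close>. A linear map out of
  \<open>A\<^sup>\<otimes>\<^sup>p \<otimes> A\<^sup>\<otimes>\<^sup>q\<close> is a map additive in each of the \<open>p + q\<close> arguments. The value
  \<open>hop A [] []\<close> is unconstrained and never used.
\<close>

record 'a hirsch_alg = "'a dg_alg" +
  hop :: "'a list \<Rightarrow> 'a list \<Rightarrow> 'a"

definition eps :: "int list \<Rightarrow> nat \<Rightarrow> int" where
  \<comment> \<open>\<open>\<epsilon>\<^sup>x\<^sub>i\<close>, where \<open>us\<close> is the list of degrees of the \<open>x\<close>'s\<close>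
  "eps us i = sum_list (take i us) + int i"

definition eps2 :: "int list \<Rightarrow> int list \<Rightarrow> nat \<Rightarrow> nat \<Rightarrow> int" where
  \<comment> \<open>\<open>\<epsilon>\<^sub>i\<^sub>,\<^sub>j\<close>\<close>
  "eps2 us vs i j = eps us i + eps vs j + (eps us i + eps us (length us)) * eps vs j + 1"

definition merge_at :: "nat \<Rightarrow> 'a::times list \<Rightarrow> 'a list" where
  \<comment> \<open>\<open>(a\<^sub>1, \<dots>, a\<^sub>i a\<^sub>i\<^sub>+\<^sub>1, \<dots>, a\<^sub>p)\<close> for \<open>1 \<le> i < p\<close>, where \<open>a\<^sub>i\<close> is \<open>as ! (i - 1)\<close>\<close>
  "merge_at i as = take (i - 1) as @ [as ! (i - 1) * as ! i] @ drop (i + 1) as"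

definition homogeneous_list :: "('a, 'm) dg_alg_scheme \<Rightarrow> int list \<Rightarrow> 'a list \<Rightarrow> bool" where
  "homogeneous_list A us as \<longleftrightarrow> list_all2 (\<lambda>u a. a \<in> grading A u) us as"

locale hirsch_algebra = dg_algebra A
  for A :: "('a::ring, 'm) hirsch_alg_scheme" +
  assumes hop_additive_left: "i < length as \<Longrightarrow> additive (\<lambda>a. hop A (as[i := a]) bs)"
    and hop_additive_right: "j < length bs \<Longrightarrow> additive (\<lambda>b. hop A as (bs[j := b]))"
    and hop_grading:
      "homogeneous_list A us as \<Longrightarrow> homogeneous_list A vs bs \<Longrightarrow> as \<noteq> [] \<or> bs \<noteq> [] \<Longrightarrow>
       hop A as bs \<in>
         grading A (sum_list us + sum_list vs + 1 - int (length as) - int (length bs))"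
    and hop_1_0: "hop A [a] [] = a"
    and hop_0_1: "hop A [] [b] = b"
    and hop_p_0: "length as > 1 \<Longrightarrow> hop A as [] = 0"
    and hop_0_p: "length bs > 1 \<Longrightarrow> hop A [] bs = 0"
    and diff_hop:
      "homogeneous_list A us as \<Longrightarrow> homogeneous_list A vs bs \<Longrightarrow>
       p = length as \<Longrightarrow> q = length bs \<Longrightarrow> p + q \<ge> 1 \<Longrightarrow>
       diff A (hop A as bs) =
         (\<Sum>i=1..p. sgn_pow (eps us (i - 1)) (hop A (as[i - 1 := diff A (as ! (i - 1))]) bs))
       + (\<Sum>j=1..q. sgn_pow (eps us p + eps vs (j - 1))
            (hop A as (bs[j - 1 := diff A (bs ! (j - 1))])))
       + (\<Sum>i=1..<p. sgn_pow (eps us i) (hop A (merge_at i as) bs))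
       + (\<Sum>j=1..<q. sgn_pow (eps us p + eps vs j) (hop A as (merge_at j bs)))
       + (\<Sum>(i, j) \<in> {0..p} \<times> {0..q} - {(0, 0), (p, q)}.
            sgn_pow (eps2 us vs i j)
              (hop A (take i as) (take j bs) * hop A (drop i as) (drop j bs)))"

definition hirsch_map ::
    "('a::ring, 'm) hirsch_alg_scheme \<Rightarrow> ('b::ring, 'n) hirsch_alg_scheme \<Rightarrow> ('a \<Rightarrow> 'b) \<Rightarrow> bool"
  where
  "hirsch_map A B f \<longleftrightarrow>
     additive f \<and>
     (\<forall>a b. f (a * b) = f a * f b) \<and>
     (\<forall>n. f ` grading A n \<subseteq> grading B n) \<and>
     (\<forall>a. f (diff A a) = diff B (f a)) \<and>
     (\<forall>as bs. as \<noteq> [] \<or> bs \<noteq> [] \<longrightarrow> f (hop A as bs) = hop B (map f as) (map f bs))"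


section \<open>Twisting sequences\<close>

text \<open>
  A sequence \<open>(x\<^sub>3, x\<^sub>5, \<dots>)\<close> is a function \<open>x\<close> on the naturals with \<open>x n\<close> standing for
  \<open>x\<^sub>2\<^sub>n\<^sub>+\<^sub>1\<close>, \<open>n \<ge> 1\<close>; the unused value \<open>x 0\<close> is normalized to \<open>0\<close>. Likewise \<open>h n\<close> below
  stands for \<open>h\<^sub>2\<^sub>n\<close>.
\<close>

definition TS :: "('a::ring, 'm) dg_alg_scheme \<Rightarrow> (nat \<Rightarrow> 'a) set" where
  "TS A = {x. x 0 = 0 \<and>
     (\<forall>n\<ge>1. x n \<in> grading A (2 * int n + 1) \<and>
            diff A (x n) + (\<Sum>i=1..<n. x i * x (n - i)) = 0)}"

definition homotopic :: "('a::ring, 'm) dg_alg_scheme \<Rightarrow> (nat \<Rightarrow> 'a) \<Rightarrow> (nat \<Rightarrow> 'a) \<Rightarrow> bool" where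
  "homotopic A x y \<longleftrightarrow>
     (\<exists>h. \<forall>n\<ge>1. h n \<in> grading A (2 * int n) \<and>
        y n - x n + diff A (h n) + (\<Sum>i=1..<n. y (n - i) * h i - h i * x (n - i)) = 0)"

definition homotopy_rel :: "('a::ring, 'm) dg_alg_scheme \<Rightarrow> ((nat \<Rightarrow> 'a) \<times> (nat \<Rightarrow> 'a)) set" where
  "homotopy_rel A = {(x, y). x \<in> TS A \<and> y \<in> TS A \<and> homotopic A x y}"

definition ts_class :: "('a::ring, 'm) dg_alg_scheme \<Rightarrow> (nat \<Rightarrow> 'a) \<Rightarrow> (nat \<Rightarrow> 'a) set" where
  "ts_class A x = homotopy_rel A `` {x}"

definition ts :: "('a::ring, 'm) dg_alg_scheme \<Rightarrow> (nat \<Rightarrow> 'a) set set" where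
  "ts A = TS A // homotopy_rel A"

text \<open>
  Homotopy is an equivalence relation: with generating functions \<open>X\<close>, \<open>Y\<close>, \<open>H\<close> it reads
  \<open>Y - X + D H + Y H - H X = 0\<close>, that is, \<open>1 + H\<close> is a gauge transformation from \<open>X\<close> to \<open>Y\<close>.
\<close>

definition gauge_err :: "('a::ring, 'm) dg_alg_scheme \<Rightarrow> 'a fps \<Rightarrow> 'a fps \<Rightarrow> 'a fps \<Rightarrow> 'a fps" where
  "gauge_err A X Y H = Y - X + Abs_fps (\<lambda>n. diff A (fps_nth H n)) + Y * H - H * X"

definition gauges :: "('a::ring, 'm) dg_alg_scheme \<Rightarrow> 'a fps set" where
  "gauges A = {H. fps_nth H 0 = 0 \<and> (\<forall>n. fps_nth H n \<in> grading A (2 * int n))}"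

lemma fps_mult_nth_zero:
  fixes X Y :: "'a::ring fps"
  assumes "fps_nth X 0 = 0" "fps_nth Y 0 = 0"
  shows "fps_nth (X * Y) n = (\<Sum>i=1..<n. fps_nth X i * fps_nth Y (n - i))"
  unfolding fps_mult_nth
proof (rule sum.mono_neutral_right)
  show "\<forall>i\<in>{0..n} - {1..<n}. fps_nth X i * fps_nth Y (n - i) = 0"
  proof
    fix i assume "i \<in> {0..n} - {1..<n}"
    then have "i = 0 \<or> i = n" by auto
    then show "fps_nth X i * fps_nth Y (n - i) = 0" using assms by auto
  qed
qed auto

context dg_algebra
begin

lemma grading_0: "0 \<in> grading A n"
  and grading_add: "a \<in> grading A n \<Longrightarrow> b \<in> grading A n \<Longrightarrow> a + b \<in> grading A n"
  and grading_uminus: "a \<in> grading A n \<Longrightarrow> - a \<in> grading A n"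
proof -
  show "0 \<in> grading A n"
    using subgroup.one_closed[OF grading_subgroup] by (simp add: additive_group_def)
  show "a \<in> grading A n \<Longrightarrow> b \<in> grading A n \<Longrightarrow> a + b \<in> grading A n"
    using subgroup.m_closed[OF grading_subgroup] by (simp add: additive_group_def)
  assume a: "a \<in> grading A n"
  have "comm_group (additive_group (UNIV :: 'a set))"
    by (rule comm_groupI) (auto simp: additive_group_def algebra_simps intro: exI[of _ "- _"])
  then have "group (additive_group (UNIV :: 'a set))"
    by (rule comm_group.axioms(2))
  then have "inv\<^bsub>additive_group UNIV\<^esub> a = - a"
    by (rule group.inv_equality) (auto simp: additive_group_def)
  then show "- a \<in> grading A n"
    using subgroup.m_inv_closed[OF grading_subgroup a] by simp
qed

lemma grading_sum: "(\<And>i. i \<in> S \<Longrightarrow> f i \<in> grading A n) \<Longrightarrow> sum f S \<in> grading A n"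
  by (induction S rule: infinite_finite_induct) (auto simp: grading_0 grading_add)

lemma mult_grading_even:
  assumes "a \<in> grading A (2 * int i)" "b \<in> grading A (2 * int (n - i))" "i \<le> n"
  shows "a * b \<in> grading A (2 * int n)"
proof -
  have "2 * int i + 2 * int (n - i) = 2 * int n" using assms(3) by simp
  then show ?thesis using mult_grading[OF assms(1,2)] by simp
qed

lemma gauges_mult:
  assumes "H \<in> gauges A" "K \<in> gauges A"
  shows "H * K \<in> gauges A"
proof -
  have "fps_nth H i * fps_nth K (n - i) \<in> grading A (2 * int n)" if "i \<le> n" for i n
    using that assms unfolding gauges_def by (intro mult_grading_even[of _ i]) blast+
  then have "fps_nth (H * K) n \<in> grading A (2 * int n)" for n
    unfolding fps_mult_nth by (intro grading_sum) auto
  then show ?thesis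
    using assms by (simp add: gauges_def)
qed

lemma gauge_err_compose:
  assumes "H \<in> gauges A" "K \<in> gauges A"
  shows "gauge_err A X Z (H + K + K * H) =
    gauge_err A X Y H + gauge_err A Y Z K + gauge_err A Y Z K * H + K * gauge_err A X Y H"
proof -
  let ?D = "\<lambda>H. Abs_fps (\<lambda>n. diff A (fps_nth H n))"
  interpret D: additive "diff A" by (rule diff_additive)
  have add: "?D (F + G) = ?D F + ?D G" for F G
    by (simp add: fps_eq_iff D.add)
  have mult: "?D (K * H) = ?D K * H + K * ?D H"
  proof -
    have "diff A (fps_nth K i * b) = diff A (fps_nth K i) * b + fps_nth K i * diff A b" for i b
      using Leibniz[of "fps_nth K i" "2 * int i" b] assms(2)
      by (simp add: gauges_def sgn_pow_def)
    then show ?thesis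
      by (simp add: fps_eq_iff fps_mult_nth D.sum sum.distrib)
  qed
  show ?thesis
    unfolding gauge_err_def add mult by (simp add: algebra_simps)
qed

lemma homotopic_iff_gauge:
  assumes "x \<in> TS A" "y \<in> TS A"
  shows "homotopic A x y \<longleftrightarrow> (\<exists>H \<in> gauges A. gauge_err A (Abs_fps x) (Abs_fps y) H = 0)"
proof -
  interpret D: additive "diff A" by (rule diff_additive)
  have 0: "x 0 = 0" "y 0 = 0" using assms by (auto simp: TS_def)
  have nth: "fps_nth (gauge_err A (Abs_fps x) (Abs_fps y) H) n =
      y n - x n + diff A (fps_nth H n)
      + (\<Sum>i=1..<n. y (n - i) * fps_nth H i - fps_nth H i * x (n - i))"
    if "fps_nth H 0 = 0" for H n
  proof -
    have "(\<Sum>i=1..<n. y i * fps_nth H (n - i)) = (\<Sum>i=1..<n. y (n - i) * fps_nth H i)"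
      by (rule sum.reindex_bij_witness[of _ "\<lambda>i. n - i" "\<lambda>i. n - i"]) auto
    then show ?thesis
      using that 0 by (simp add: gauge_err_def fps_mult_nth_zero sum_subtractf)
  qed
  show ?thesis
  proof
    assume "homotopic A x y"
    then obtain h where h: "\<And>n. n \<ge> 1 \<Longrightarrow> h n \<in> grading A (2 * int n)"
      "\<And>n. n \<ge> 1 \<Longrightarrow>
         y n - x n + diff A (h n) + (\<Sum>i=1..<n. y (n - i) * h i - h i * x (n - i)) = 0"
      unfolding homotopic_def by blast
    define H where "H = Abs_fps (\<lambda>n. if n = 0 then 0 else h n)"
    have H0: "fps_nth H 0 = 0" by (simp add: H_def)
    have "H \<in> gauges A" using h(1) by (auto simp: gauges_def H_def grading_0)
    moreover have "gauge_err A (Abs_fps x) (Abs_fps y) H = 0"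
    proof (rule fps_ext)
      fix n
      show "fps_nth (gauge_err A (Abs_fps x) (Abs_fps y) H) n = fps_nth 0 n"
      proof (cases "n = 0")
        case True
        then show ?thesis unfolding nth[OF H0] using 0 H0 by (simp add: D.zero)
      next
        case False
        then show ?thesis unfolding nth[OF H0] using h(2)[of n] by (simp add: H_def)
      qed
    qed
    ultimately show "\<exists>H \<in> gauges A. gauge_err A (Abs_fps x) (Abs_fps y) H = 0" by blast
  next
    assume "\<exists>H \<in> gauges A. gauge_err A (Abs_fps x) (Abs_fps y) H = 0"
    then obtain H where H: "H \<in> gauges A" "gauge_err A (Abs_fps x) (Abs_fps y) H = 0" by blast
    then have H0: "fps_nth H 0 = 0" by (simp add: gauges_def)
    show "homotopic A x y"
      unfolding homotopic_def
      using H nth[OF H0] by (intro exI[of _ "fps_nth H"]) (simp add: gauges_def)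
  qed
qed

lemma gauge_inverse:
  assumes "H \<in> gauges A"
  obtains K where "K \<in> gauges A" "H + K + K * H = 0"
proof -
  define g where "g = rec_nat (\<lambda>_. 0)
     (\<lambda>N r n. - fps_nth H n - (\<Sum>i=1..<n. r i * fps_nth H (n - i)))"
  have g_Suc: "g (Suc N) n = - fps_nth H n - (\<Sum>i=1..<n. g N i * fps_nth H (n - i))" for N n
    by (simp add: g_def)
  have stable: "n < N \<Longrightarrow> n < M \<Longrightarrow> g N n = g M n" for N M n
  proof (induction N arbitrary: M n)
    case (Suc N)
    then obtain M' where M: "M = Suc M'" by (cases M) auto
    have "g N i = g M' i" if "i \<in> {1..<n}" for i
      using that Suc.prems M by (intro Suc.IH) auto
    then show ?case unfolding M g_Suc by simp
  qed simp
  define K where "K = Abs_fps (\<lambda>n. g (Suc n) n)"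
  have H0: "fps_nth H 0 = 0" using assms by (simp add: gauges_def)
  have K_eq: "fps_nth K n = - fps_nth H n - (\<Sum>i=1..<n. fps_nth K i * fps_nth H (n - i))" for n
  proof -
    have "g n i = fps_nth K i" if "i \<in> {1..<n}" for i
      using that by (auto simp: K_def intro: stable)
    then show ?thesis by (simp add: K_def g_Suc)
  qed
  have K0: "fps_nth K 0 = 0" using K_eq[of 0] H0 by simp
  have "fps_nth K n \<in> grading A (2 * int n)" for n
  proof (induction n rule: less_induct)
    case (less n)
    have "fps_nth K i * fps_nth H (n - i) \<in> grading A (2 * int n)" if "i \<in> {1..<n}" for i
    proof (rule mult_grading_even)
      show "fps_nth K i \<in> grading A (2 * int i)" using less[of i] that by simp
      show "fps_nth H (n - i) \<in> grading A (2 * int (n - i))"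
        using assms unfolding gauges_def by blast
    qed (use that in simp)
    then have "(\<Sum>i=1..<n. fps_nth K i * fps_nth H (n - i)) \<in> grading A (2 * int n)"
      by (intro grading_sum)
    then have "- fps_nth H n + - (\<Sum>i=1..<n. fps_nth K i * fps_nth H (n - i))
        \<in> grading A (2 * int n)"
      using assms by (intro grading_add grading_uminus) (auto simp: gauges_def)
    then show ?case by (subst K_eq) simp
  qed
  then have "K \<in> gauges A" using K0 by (simp add: gauges_def)
  moreover have "H + K + K * H = 0"
  proof (rule fps_ext)
    fix n
    show "fps_nth (H + K + K * H) n = fps_nth 0 n"
      using K_eq[of n] by (simp add: fps_mult_nth_zero[OF K0 H0])
  qed
  ultimately show ?thesis by (rule that)
qed

lemma fps_zero_if_mult:
  fixes F H :: "'a fps"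
  assumes "F + F * H = 0" "fps_nth H 0 = 0"
  shows "F = 0"
proof (rule fps_ext)
  fix n
  show "fps_nth F n = fps_nth 0 n"
  proof (induction n rule: less_induct)
    case (less n)
    have "fps_nth F i * fps_nth H (n - i) = 0" if "i \<le> n" for i
      using less[of i] that assms(2) by (cases "i = n") auto
    then have "fps_nth (F * H) n = 0" by (simp add: fps_mult_nth)
    then show ?case
      using arg_cong[OF assms(1), of "\<lambda>G. fps_nth G n"] by simp
  qed
qed

lemma equiv_homotopy_rel: "equiv (TS A) (homotopy_rel A)"
proof (rule equivI)
  interpret D: additive "diff A" by (rule diff_additive)
  have zero: "0 \<in> gauges A" "gauge_err A X X 0 = 0" for X
    by (auto simp: gauges_def gauge_err_def grading_0 D.zero fps_eq_iff)
  show "homotopy_rel A \<subseteq> TS A \<times> TS A"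
    by (auto simp: homotopy_rel_def)
  show "refl_on (TS A) (homotopy_rel A)"
    using zero by (auto intro!: refl_onI bexI[of _ 0] simp: homotopy_rel_def homotopic_iff_gauge)
  show "sym (homotopy_rel A)"
  proof (rule symI)
    fix x y assume "(x, y) \<in> homotopy_rel A"
    then have xy: "x \<in> TS A" "y \<in> TS A" "homotopic A x y" by (auto simp: homotopy_rel_def)
    then obtain H where H: "H \<in> gauges A" "gauge_err A (Abs_fps x) (Abs_fps y) H = 0"
      by (auto simp: homotopic_iff_gauge)
    obtain K where K: "K \<in> gauges A" "H + K + K * H = 0"
      using gauge_inverse[OF H(1)] .
    let ?F = "gauge_err A (Abs_fps y) (Abs_fps x) K"
    have "?F + ?F * H = 0"
      using gauge_err_compose[OF H(1) K(1), of "Abs_fps x" "Abs_fps x" "Abs_fps y"] H(2) K(2) zero(2)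
      by simp
    then have "?F = 0"
      by (rule fps_zero_if_mult) (use H(1) in \<open>simp add: gauges_def\<close>)
    then show "(y, x) \<in> homotopy_rel A"
      using xy K(1) by (auto simp: homotopy_rel_def homotopic_iff_gauge)
  qed
  show "trans (homotopy_rel A)"
  proof (rule transI)
    fix x y z assume "(x, y) \<in> homotopy_rel A" "(y, z) \<in> homotopy_rel A"
    then have xyz: "x \<in> TS A" "y \<in> TS A" "z \<in> TS A" "homotopic A x y" "homotopic A y z"
      by (auto simp: homotopy_rel_def)
    then obtain H K where HK: "H \<in> gauges A" "gauge_err A (Abs_fps x) (Abs_fps y) H = 0"
      "K \<in> gauges A" "gauge_err A (Abs_fps y) (Abs_fps z) K = 0"
      by (auto simp: homotopic_iff_gauge)
    have "gauge_err A (Abs_fps x) (Abs_fps z) (H + K + K * H) = 0"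
      using gauge_err_compose[OF HK(1,3), of "Abs_fps x" "Abs_fps z" "Abs_fps y"] HK by simp
    moreover have "H + K + K * H \<in> gauges A"
      using HK gauges_mult[OF HK(3,1)] by (auto simp: gauges_def intro!: grading_add)
    ultimately show "(x, z) \<in> homotopy_rel A"
      using xyz by (auto simp: homotopy_rel_def homotopic_iff_gauge)
  qed
qed

end

text \<open>
  The summands of \<open>\<mu>(x, y)\<^sub>2\<^sub>k\<^sub>+\<^sub>1\<close> are indexed by the pairs of lists \<open>is = [i\<^sub>1, \<dots>, i\<^sub>m]\<close> and
  \<open>js = [j\<^sub>1, \<dots>, j\<^sub>n]\<close>; the lengths \<open>m\<close> and \<open>n\<close> vary with them.
\<close>

definition mu_index :: "nat \<Rightarrow> (nat list \<times> nat list) set" where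
  "mu_index k = {(is, js). (is, js) \<noteq> ([], []) \<and> (\<forall>i \<in> set is. i \<ge> 1) \<and> (\<forall>j \<in> set js. j \<ge> 1) \<and>
                   sum_list is + sum_list js = k}"

definition mu ::
    "('a::ring, 'm) hirsch_alg_scheme \<Rightarrow> (nat \<Rightarrow> 'a) \<Rightarrow> (nat \<Rightarrow> 'a) \<Rightarrow> nat \<Rightarrow> 'a" where
  "mu A x y k = (\<Sum>(is, js) \<in> mu_index k. hop A (map x is) (map y js))"

lemma length_le_sum_list: "\<forall>i \<in> set is. (i::nat) \<ge> 1 \<Longrightarrow> length is \<le> sum_list is"
  by (induction "is") auto

lemma finite_mu_index: "finite (mu_index k)"
proof (rule finite_subset)
  let ?L = "{xs :: nat list. set xs \<subseteq> {..k} \<and> length xs \<le> k}"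
  show "mu_index k \<subseteq> ?L \<times> ?L"
    using length_le_sum_list member_le_sum_list
    by (fastforce simp: mu_index_def)
  show "finite (?L \<times> ?L)"
    by (intro finite_cartesian_product finite_lists_length_le) auto
qed

lemma mu_0: "mu A x y 0 = 0"
proof -
  have "mu_index 0 = {}"
    by (auto simp: mu_index_def neq_Nil_conv)
  then show ?thesis
    by (simp add: mu_def)
qed

end

theory Submission
  imports Defs
begin

text \<open>
  The Hirsch relation says that the \<open>E\<^sub>p\<^sub>,\<^sub>q\<close> form a twisting cochain on the tensor product of two
  bar constructions. A twisting sequence \<open>x\<close> gives the sum \<open>\<Sum> [x\<^sub>i\<^sub>1 | \<dots> | x\<^sub>i\<^sub>m]\<close>, which is a
  cycle for the bar differential and is group-like for deconcatenation, and \<open>\<mu>(x, y)\<close> is the value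
  of the twisting cochain on the product of two such sums; hence \<open>d \<mu> = - \<mu> \<mu>\<close>.

  If \<open>h\<close> is a homotopy from \<open>x\<close> to \<open>x'\<close>, the bar differential of
  \<open>\<Sum> [x' | \<dots> | x' | h | x | \<dots> | x]\<close> is the difference of the sums for \<open>x\<close> and \<open>x'\<close>, and its
  deconcatenations split either before or after \<open>h\<close>. So
  \<open>H = \<Sum> E(x', \<dots>, x', h, x, \<dots>, x; y, \<dots>, y)\<close> is a homotopy from \<open>\<mu>(x, y)\<close> to \<open>\<mu>(x', y)\<close>, and
  the same expression in the second group of arguments handles homotopies of \<open>y\<close>.
  All words in the \<open>x\<^sub>i\<close> have even degree after the shift by one, so the only signs left come
  from moving past \<open>h\<close>.
\<close>

section \<open>Multiadditive maps on lists and parity signs\<close>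

text \<open>One function on lists packages a family of linear maps out of all tensor powers at once;
  its value at \<open>[]\<close> is unconstrained.\<close>

definition multiadditive :: "('a::ab_group_add list \<Rightarrow> 'b::ab_group_add) \<Rightarrow> bool" where
  "multiadditive \<Phi> \<longleftrightarrow> (\<forall>i as. i < length as \<longrightarrow> additive (\<lambda>a. \<Phi> (as[i := a])))"

text \<open>Inductions on words absorb the first letter into \<open>\<Phi>\<close>, and this keeps
  the hypothesis available for the rest of the word.\<close>

lemma multiadditive_Cons: "multiadditive \<Phi> \<Longrightarrow> multiadditive (\<lambda>as. \<Phi> (a # as))"
  unfolding multiadditive_def
proof (intro allI impI)
  fix i as
  assume "\<forall>i as. i < length as \<longrightarrow> additive (\<lambda>a. \<Phi> (as[i := a]))" "i < length (as :: 'a list)"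
  then have "additive (\<lambda>b. \<Phi> ((a # as)[Suc i := b]))"
    by (metis Suc_less_eq length_Cons)
  then show "additive (\<lambda>b. \<Phi> (a # as[i := b]))" by simp
qed

lemma multiadditive_hd:
  assumes "multiadditive \<Phi>"
  shows "additive (\<lambda>a. \<Phi> (a # as))"
proof -
  have "additive (\<lambda>a. \<Phi> ((undefined # as)[0 := a]))"
    using assms unfolding multiadditive_def by (metis length_Cons zero_less_Suc)
  then show ?thesis by simp
qed

lemma sgn_pow_add: "sgn_pow n (a + b) = sgn_pow n a + sgn_pow n b"
  by (simp add: sgn_pow_def)

lemma sgn_pow_zero: "sgn_pow n 0 = 0"
  by (simp add: sgn_pow_def)

lemma sgn_pow_sgn_pow: "sgn_pow m (sgn_pow n a) = sgn_pow (m + n) a"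
  by (simp add: sgn_pow_def)

lemma sgn_pow_sum: "sgn_pow n (sum f S) = (\<Sum>i\<in>S. sgn_pow n (f i))"
  by (simp add: sgn_pow_def sum_negf)

lemma eps_Cons: "eps (u # us) (Suc i) = u + 1 + eps us i"
  by (simp add: eps_def)

lemma eps_0: "eps us 0 = 0"
  by (simp add: eps_def)

section \<open>Compositions and Cauchy products\<close>

definition compositions :: "nat \<Rightarrow> nat list set" where
  "compositions m = {is. (\<forall>i \<in> set is. i \<ge> 1) \<and> sum_list is = m}"

lemma finite_compositions: "finite (compositions m)"
proof (rule finite_subset)
  show "compositions m \<subseteq> {xs. set xs \<subseteq> {..m} \<and> length xs \<le> m}"
    using length_le_sum_list member_le_sum_list by (fastforce simp: compositions_def)
qed (intro finite_lists_length_le, simp)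

lemma compositions_0: "compositions 0 = {[]}"
proof -
  have "is = []" if "\<forall>i\<in>set is. i \<ge> 1" "sum_list is = 0" for "is" :: "nat list"
    using that by (cases "is") auto
  then show ?thesis by (auto simp: compositions_def)
qed

text \<open>Splitting off the first part matches the recursion of \<open>bar_diff\<close>; for
  \<open>m > 0\<close> the empty list is not a composition.\<close>

lemma sum_compositions:
  assumes "m > 0"
  shows "sum f (compositions m) = (\<Sum>i=1..m. \<Sum>is\<in>compositions (m - i). f (i # is))"
proof -
  have "sum f (compositions m) =
      (\<Sum>(i, is) \<in> Sigma {1..m} (\<lambda>i. compositions (m - i)). f (i # is))"
    by (rule sum.reindex_bij_witness[of _ "\<lambda>(i, is). i # is" "\<lambda>is. (hd is, tl is)"])
      (use assms in \<open>auto simp: compositions_def neq_Nil_conv split: list.splits\<close>,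
       (metis list.exhaust_sel list.set_sel sum_list.Nil less_not_refl sum_list.Cons
         diff_add_inverse le_add1 One_nat_def)+)
  then show ?thesis
    by (simp add: sum.Sigma finite_compositions)
qed

text \<open>
  A triple \<open>(us, n, vs)\<close> encodes the word \<open>x', \<dots>, x', h, x, \<dots>, x\<close> with indices \<open>us\<close> for the
  letters \<open>x'\<close>, index \<open>n\<close> for \<open>h\<close>, and indices \<open>vs\<close> for the letters \<open>x\<close>.
\<close>

definition pointed_compositions :: "nat \<Rightarrow> (nat list \<times> nat \<times> nat list) set" where
  "pointed_compositions m =
     {(us, n, vs). (\<forall>i \<in> set us \<union> {n} \<union> set vs. i \<ge> 1) \<and> sum_list us + n + sum_list vs = m}"

lemma finite_pointed_compositions: "finite (pointed_compositions m)"
proof (rule finite_subset)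
  let ?C = "\<Union>a\<le>m. compositions a"
  show "pointed_compositions m \<subseteq> ?C \<times> {..m} \<times> ?C"
    by (auto simp: pointed_compositions_def compositions_def)
  show "finite (?C \<times> {..m} \<times> ?C)"
    by (intro finite_cartesian_product finite_UN_I finite_compositions) auto
qed

text \<open>The first letter is either \<open>h\<close>, leaving an ordinary word in
  \<open>x\<close>, or some \<open>x'\<close>, leaving a shorter pointed word.\<close>

lemma sum_pointed_compositions:
  "sum f (pointed_compositions m) =
     (\<Sum>n=1..m. \<Sum>vs\<in>compositions (m - n). f ([], n, vs)) +
     (\<Sum>u=1..m. \<Sum>(us, n, vs)\<in>pointed_compositions (m - u). f (u # us, n, vs))"
proof -
  let ?P = "pointed_compositions m"
  let ?N = "{t \<in> ?P. fst t = []}" and ?C = "{t \<in> ?P. fst t \<noteq> []}"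
  have P: "?P = ?N \<union> ?C" by auto
  have "sum f ?P = sum f ?N + sum f ?C"
    by (subst P, rule sum.union_disjoint)
      (auto intro: rev_finite_subset[OF finite_pointed_compositions[of m]])
  moreover have "sum f ?N =
      (\<Sum>(n, vs) \<in> Sigma {1..m} (\<lambda>n. compositions (m - n)). f ([], n, vs))"
    by (rule sum.reindex_bij_witness[of _ "\<lambda>(n, vs). ([], n, vs)" "\<lambda>(us, n, vs). (n, vs)"])
      (auto simp: compositions_def pointed_compositions_def)
  moreover have "sum f ?C =
      (\<Sum>(u, us, n, vs) \<in> Sigma {1..m} (\<lambda>u. pointed_compositions (m - u)). f (u # us, n, vs))"
    by (rule sum.reindex_bij_witness[of _ "\<lambda>(u, us, n, vs). (u # us, n, vs)"
          "\<lambda>(us, n, vs). (hd us, tl us, n, vs)"])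
      (auto simp: pointed_compositions_def neq_Nil_conv)
  ultimately show ?thesis
    by (simp add: sum.Sigma finite_compositions finite_pointed_compositions)
qed

text \<open>Both sides run over positive \<open>i\<close>, \<open>j\<close> with
  \<open>i + j \<le> m\<close>, the right one grouped by \<open>n = i + j\<close>. This collects
  products of adjacent letters into the quadratic terms of the twisting and homotopy
  equations.\<close>

lemma sum_triangle:
  fixes F :: "nat \<Rightarrow> nat \<Rightarrow> 'a::comm_monoid_add"
  shows "(\<Sum>i=1..m. \<Sum>j=1..m - i. F i j) = (\<Sum>n=1..m. \<Sum>i=1..<n. F i (n - i))"
proof -
  have "(\<Sum>(i, j) \<in> Sigma {1..m} (\<lambda>i. {1..m - i}). F i j) =
      (\<Sum>(n, i) \<in> Sigma {1..m} (\<lambda>n. {1..<n}). F i (n - i))"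
    by (rule sum.reindex_bij_witness[of _ "\<lambda>(n, i). (i, n - i)" "\<lambda>(i, j). (i + j, i)"]) auto
  then show ?thesis by (simp add: sum.Sigma)
qed

section \<open>Deconcatenation of index lists\<close>

lemma sum_list_drop: "sum_list (drop i is) = sum_list is - sum_list (take i is)"
  and sum_list_take_le: "sum_list (take i is) \<le> sum_list is"
  for "is" :: "nat list"
proof -
  have "sum_list (take i is) + sum_list (drop i is) = sum_list is"
    by (metis append_take_drop_id sum_list_append)
  then show "sum_list (drop i is) = sum_list is - sum_list (take i is)"
    "sum_list (take i is) \<le> sum_list is" by simp_all
qed

text \<open>Concatenation identifies pairs of compositions with compositions carrying a marked cut:
  the sum of all words is group-like for deconcatenation.\<close>

lemma sum_compositions_split:
  "(\<Sum>is\<in>compositions m. \<Sum>i\<le>length is. g (take i is) (drop i is)) =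
   (\<Sum>a\<le>m. \<Sum>is\<in>compositions a. \<Sum>js\<in>compositions (m - a). g is js)"
proof -
  have "(\<Sum>(is, i) \<in> Sigma (compositions m) (\<lambda>is. {..length is}). g (take i is) (drop i is)) =
      (\<Sum>(a, is, js) \<in> Sigma {..m} (\<lambda>a. compositions a \<times> compositions (m - a)). g is js)"
    by (rule sum.reindex_bij_witness[of _ "\<lambda>(a, is, js). (is @ js, length is)"
          "\<lambda>(is, i). (sum_list (take i is), take i is, drop i is)"])
      (auto simp: compositions_def dest: in_set_takeD in_set_dropD simp: sum_list_take_le sum_list_drop)
  then show ?thesis
    by (simp add: sum.Sigma finite_compositions sum.cartesian_product)
qed

text \<open>These are the cuts before \<open>h\<close>: the left piece is an ordinary word in
  \<open>x'\<close> and the right piece still contains \<open>h\<close>.\<close>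

lemma sum_pointed_compositions_split_left:
  "(\<Sum>t\<in>pointed_compositions m. \<Sum>i\<le>length (fst t). g (take i (fst t)) (drop i (fst t), snd t)) =
   (\<Sum>a\<le>m. \<Sum>is\<in>compositions a. \<Sum>t\<in>pointed_compositions (m - a). g is t)"
proof -
  have "(\<Sum>((us, n, vs), i) \<in> Sigma (pointed_compositions m) (\<lambda>(us, n, vs). {..length us}).
        g (take i us) (drop i us, n, vs)) =
      (\<Sum>(a, is, t) \<in> Sigma {..m} (\<lambda>a. compositions a \<times> pointed_compositions (m - a)). g is t)"
    by (rule sum.reindex_bij_witness[of _ "\<lambda>(a, is, us, n, vs). ((is @ us, n, vs), length is)"
          "\<lambda>((us, n, vs), i). (sum_list (take i us), take i us, drop i us, n, vs)"])
      (auto simp: compositions_def pointed_compositions_def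
        dest: in_set_takeD in_set_dropD simp: sum_list_drop trans_le_add1 sum_list_take_le)
  then show ?thesis
    by (simp add: sum.Sigma finite_compositions finite_pointed_compositions
        sum.cartesian_product case_prod_unfold)
qed

text \<open>These are the cuts after \<open>h\<close>: the left piece contains \<open>h\<close> and
  the right piece is an ordinary word in \<open>x\<close>.\<close>

lemma sum_pointed_compositions_split_right:
  "(\<Sum>t\<in>pointed_compositions m. \<Sum>i\<le>length (snd (snd t)).
     g (fst t, fst (snd t), take i (snd (snd t))) (drop i (snd (snd t)))) =
   (\<Sum>a\<le>m. \<Sum>t\<in>pointed_compositions a. \<Sum>is\<in>compositions (m - a). g t is)"
proof -
  have "(\<Sum>((us, n, vs), i) \<in> Sigma (pointed_compositions m) (\<lambda>(us, n, vs). {..length vs}).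
        g (us, n, take i vs) (drop i vs)) =
      (\<Sum>(a, t, is) \<in> Sigma {..m} (\<lambda>a. pointed_compositions a \<times> compositions (m - a)). g t is)"
    by (rule sum.reindex_bij_witness[of _ "\<lambda>(a, (us, n, vs), is). ((us, n, vs @ is), length vs)"
          "\<lambda>((us, n, vs), i). (sum_list us + n + sum_list (take i vs), (us, n, take i vs), drop i vs)"])
      (auto simp: compositions_def pointed_compositions_def
        dest: in_set_takeD in_set_dropD simp: sum_list_take_le sum_list_drop)
  then show ?thesis
    by (simp add: sum.Sigma finite_compositions finite_pointed_compositions
        sum.cartesian_product case_prod_unfold)
qed

section \<open>Cauchy products of sums over pairs of words\<close>

text \<open>\<open>P\<close> and \<open>Q\<close> are index families graded by weight; the value at
  \<open>k\<close> is the weight \<open>k\<close> part of \<open>F\<close> evaluated on the two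
  formal sums.\<close>

definition cauchy_sum ::
    "(nat \<Rightarrow> 'i set) \<Rightarrow> (nat \<Rightarrow> 'j set) \<Rightarrow> ('i \<Rightarrow> 'j \<Rightarrow> 'a::comm_monoid_add) \<Rightarrow> nat \<Rightarrow> 'a" where
  "cauchy_sum P Q F k = (\<Sum>a\<le>k. \<Sum>p\<in>P a. \<Sum>q\<in>Q (k - a). F p q)"

text \<open>Four weights with total \<open>k\<close> are grouped on the left by the weight of the
  first word, that is of both its pieces, and on the right by the weight of the left pieces of both
  words.\<close>

lemma sum_four_indices:
  fixes F :: "nat \<Rightarrow> nat \<Rightarrow> nat \<Rightarrow> nat \<Rightarrow> 'a::comm_monoid_add"
  shows "(\<Sum>a\<le>k. \<Sum>i\<le>a. \<Sum>j\<le>k - a. F i (a - i) j (k - a - j)) =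
    (\<Sum>n\<le>k. \<Sum>i\<le>n. \<Sum>l\<le>k - n. F i l (n - i) (k - n - l))"
proof -
  have "(\<Sum>(a, i, j) \<in> Sigma {..k} (\<lambda>a. {..a} \<times> {..k - a}). F i (a - i) j (k - a - j)) =
    (\<Sum>(n, i, l) \<in> Sigma {..k} (\<lambda>n. {..n} \<times> {..k - n}). F i l (n - i) (k - n - l))"
    by (rule sum.reindex_bij_witness[of _ "\<lambda>(n, i, l). (i + l, i, n - i)"
          "\<lambda>(a, i, j). (i + j, i, a - i)"]) (auto intro!: arg_cong2[where f = "F _ _"])
  then show ?thesis
    by (simp add: sum.Sigma sum.cartesian_product)
qed

lemma cauchy_sum_mult:
  fixes F :: "_ \<Rightarrow> _ \<Rightarrow> 'a::semiring_0"
  shows "(\<Sum>n\<le>k. cauchy_sum P Q F n * cauchy_sum P' Q' G (k - n)) =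
    (\<Sum>a\<le>k. \<Sum>i\<le>a. \<Sum>p\<in>P i. \<Sum>p'\<in>P' (a - i). \<Sum>j\<le>k - a. \<Sum>q\<in>Q j. \<Sum>q'\<in>Q' (k - a - j).
       F p q * G p' q')"
proof -
  let ?T = "\<lambda>i l j m. \<Sum>p\<in>P i. \<Sum>p'\<in>P' l. \<Sum>q\<in>Q j. \<Sum>q'\<in>Q' m. F p q * G p' q'"
  have prod: "(\<Sum>p\<in>P i. \<Sum>q\<in>Q j. F p q) * (\<Sum>p'\<in>P' l. \<Sum>q'\<in>Q' m. G p' q') = ?T i l j m"
    for i l j m
    by (subst sum_product) (simp add: sum_product)
  have "(\<Sum>n\<le>k. cauchy_sum P Q F n * cauchy_sum P' Q' G (k - n)) =
      (\<Sum>n\<le>k. \<Sum>i\<le>n. \<Sum>l\<le>k - n. ?T i l (n - i) (k - n - l))"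
    by (simp only: cauchy_sum_def sum_product[of _ "{.._}" _ "{.._}"] prod)
  also have "\<dots> = (\<Sum>a\<le>k. \<Sum>i\<le>a. \<Sum>j\<le>k - a. ?T i (a - i) j (k - a - j))"
    by (rule sum_four_indices[symmetric])
  also have "\<dots> = (\<Sum>a\<le>k. \<Sum>i\<le>a. \<Sum>p\<in>P i. \<Sum>p'\<in>P' (a - i). \<Sum>j\<le>k - a. \<Sum>q\<in>Q j.
      \<Sum>q'\<in>Q' (k - a - j). F p q * G p' q')"
    by (intro sum.cong refl, subst sum.swap, intro sum.cong refl, rule sum.swap)
  finally show ?thesis .
qed

text \<open>Cutting both words independently regroups into a product of two sums. Index families and
  cutting maps are abstract, to cover ordinary words and both kinds of cuts of pointed words in
  either argument.\<close>

lemma cauchy_sum_mult_split: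
  fixes F :: "'p \<Rightarrow> 'q \<Rightarrow> 'a::semiring_0"
  assumes R: "\<And>m g. (\<Sum>r\<in>R m. \<Sum>i\<le>len r. g (tk i r) (dr i r)) =
      (\<Sum>a\<le>m. \<Sum>p\<in>P a. \<Sum>p'\<in>P' (m - a). (g p p' :: 'a))"
    and S: "\<And>m g. (\<Sum>s\<in>S m. \<Sum>j\<le>len' s. g (tk' j s) (dr' j s)) =
      (\<Sum>b\<le>m. \<Sum>q\<in>Q b. \<Sum>q'\<in>Q' (m - b). (g q q' :: 'a))"
  shows "cauchy_sum R S (\<lambda>r s. \<Sum>i\<le>len r. \<Sum>j\<le>len' s.
      F (tk i r) (tk' j s) * G (dr i r) (dr' j s)) k =
    (\<Sum>n\<le>k. cauchy_sum P Q F n * cauchy_sum P' Q' G (k - n))"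
proof -
  have "cauchy_sum R S (\<lambda>r s. \<Sum>i\<le>len r. \<Sum>j\<le>len' s.
      F (tk i r) (tk' j s) * G (dr i r) (dr' j s)) k =
    (\<Sum>a\<le>k. \<Sum>r\<in>R a. \<Sum>i\<le>len r. \<Sum>s\<in>S (k - a). \<Sum>j\<le>len' s.
      F (tk i r) (tk' j s) * G (dr i r) (dr' j s))"
    unfolding cauchy_sum_def by (intro sum.cong refl, rule sum.swap)
  also have "\<dots> = (\<Sum>a\<le>k. \<Sum>r\<in>R a. \<Sum>i\<le>len r. \<Sum>b\<le>k - a. \<Sum>q\<in>Q b. \<Sum>q'\<in>Q' (k - a - b).
      F (tk i r) q * G (dr i r) q')"
    by (intro sum.cong refl S)
  also have "\<dots> = (\<Sum>a\<le>k. \<Sum>i\<le>a. \<Sum>p\<in>P i. \<Sum>p'\<in>P' (a - i). \<Sum>b\<le>k - a. \<Sum>q\<in>Q b.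
      \<Sum>q'\<in>Q' (k - a - b). F p q * G p' q')"
    by (intro sum.cong refl R)
  finally show ?thesis
    by (simp add: cauchy_sum_mult)
qed

section \<open>The bar differential\<close>

type_synonym 'a word = "(int \<times> 'a) list"

text \<open>The bar term multiplying \<open>a\<close> into the first letter of the remaining word;
  an empty remainder offers no such letter.\<close>

primrec merge_hd :: "('a::ring list \<Rightarrow> 'a) \<Rightarrow> 'a \<Rightarrow> 'a list \<Rightarrow> 'a" where
  "merge_hd \<Phi> a [] = 0"
| "merge_hd \<Phi> a (b # bs) = \<Phi> (a * b # bs)"

lemma sum_merge_hd_compositions:
  "(\<Sum>is\<in>compositions m. merge_hd \<Phi> a (map x is)) =
   (\<Sum>i=1..m. \<Sum>is\<in>compositions (m - i). \<Phi> (a * x i # map x is))"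
  by (cases "m = 0") (simp_all add: compositions_0 sum_compositions)

text \<open>Additivity in the first argument gathers the products of two leading letters of total
  weight \<open>n\<close>. \<open>S\<close> and \<open>g\<close> stay arbitrary because the tail may
  be an ordinary or a pointed word.\<close>

lemma sum_mult_hd:
  fixes m :: nat
  assumes "multiadditive \<Phi>"
  shows "(\<Sum>i=1..m. \<Sum>j=1..m - i. \<Sum>s\<in>S (m - i - j). \<Phi> (x i * y j # g s)) =
    (\<Sum>n=1..m. \<Sum>s\<in>S (m - n). \<Phi> ((\<Sum>i=1..<n. x i * y (n - i)) # g s))"
proof -
  have "\<Phi> ((\<Sum>i=1..<n. x i * y (n - i)) # g s) = (\<Sum>i=1..<n. \<Phi> (x i * y (n - i) # g s))"
    for n s
    by (rule additive.sum[OF multiadditive_hd[OF assms]])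
  then have "(\<Sum>n=1..m. \<Sum>s\<in>S (m - n). \<Phi> ((\<Sum>i=1..<n. x i * y (n - i)) # g s)) =
      (\<Sum>n=1..m. \<Sum>i=1..<n. \<Sum>s\<in>S (m - n). \<Phi> (x i * y (n - i) # g s))"
    by (simp add: sum.swap[of _ _ "S _"])
  also have "\<dots> = (\<Sum>n=1..m. \<Sum>i=1..<n. \<Sum>s\<in>S (m - i - (n - i)). \<Phi> (x i * y (n - i) # g s))"
    by simp
  finally show ?thesis
    by (simp only: sum_triangle[where F = "\<lambda>i j. \<Sum>s\<in>S (m - i - j). \<Phi> (x i * y j # g s)"])
qed

section \<open>Words of twisting sequences and of homotopies\<close>

definition ts_word :: "(nat \<Rightarrow> 'a) \<Rightarrow> nat list \<Rightarrow> 'a word" where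
  "ts_word x is = map (\<lambda>i. (2 * int i + 1, x i)) is"

definition homotopy_word ::
    "(nat \<Rightarrow> 'a) \<Rightarrow> (nat \<Rightarrow> 'a) \<Rightarrow> (nat \<Rightarrow> 'a) \<Rightarrow> nat list \<times> nat \<times> nat list \<Rightarrow> 'a word" where
  "homotopy_word x' h x = (\<lambda>(us, n, vs). ts_word x' us @ (2 * int n, h n) # ts_word x vs)"

lemma ts_word_simps [simp]:
  "ts_word x [] = []"
  "ts_word x (i # is) = (2 * int i + 1, x i) # ts_word x is"
  "map snd (ts_word x is) = map x is"
  "length (ts_word x is) = length is"
  "take k (ts_word x is) = ts_word x (take k is)"
  "drop k (ts_word x is) = ts_word x (drop k is)"
  by (simp_all add: ts_word_def comp_def take_map drop_map)

text \<open>Each letter has degree \<open>2i + 1\<close> and contributes the even number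
  \<open>2i + 2\<close>.\<close>

lemma even_eps_ts_word: "i \<le> length is \<Longrightarrow> even (eps (map fst (ts_word x is)) i)"
proof (induction "is" arbitrary: i)
  case (Cons a "is")
  then show ?case by (cases i) (simp_all add: eps_Cons eps_0)
qed (simp add: eps_0)

text \<open>The letter \<open>h\<close> contributes the odd number \<open>2n + 1\<close> and all
  others an even one, so the parity records whether the cut lies before \<open>h\<close>.\<close>

lemma even_eps_homotopy_word:
  "i \<le> length us + length vs + 1 \<Longrightarrow>
   even (eps (map fst (homotopy_word x' h x (us, n, vs))) i) \<longleftrightarrow> i \<le> length us"
proof (induction us arbitrary: i)
  case Nil
  then show ?case
    using even_eps_ts_word[of _ vs x]
    by (cases i) (simp_all add: eps_Cons eps_0 homotopy_word_def)
next
  case (Cons u us)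
  then show ?case
    by (cases i) (simp_all add: eps_Cons eps_0 homotopy_word_def)
qed

context dg_algebra
begin

text \<open>
  The map \<open>\<Phi>\<close> applied to the bar differential of the word \<open>[c\<^sub>1 | \<dots> | c\<^sub>p]\<close>; the degrees
  recorded in the word serve only to determine the signs.
\<close>

primrec bar_diff :: "('a list \<Rightarrow> 'a) \<Rightarrow> 'a word \<Rightarrow> 'a" where
  "bar_diff \<Phi> [] = 0"
| "bar_diff \<Phi> (c # w) = \<Phi> (diff A (snd c) # map snd w) +
     sgn_pow (fst c + 1)
       (bar_diff (\<lambda>as. \<Phi> (snd c # as)) w + merge_hd \<Phi> (snd c) (map snd w))"

text \<open>The recursion suits inductions on words; this closed form ties it to the differential
  and merge sums that \<open>diff_hop\<close> has for one group of arguments.\<close>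

lemma bar_diff_eq:
  "bar_diff \<Phi> w =
     (\<Sum>i=1..length w. sgn_pow (eps (map fst w) (i - 1))
        (\<Phi> ((map snd w)[i - 1 := diff A (map snd w ! (i - 1))]))) +
     (\<Sum>i=1..<length w. sgn_pow (eps (map fst w) i) (\<Phi> (merge_at i (map snd w))))"
proof (induction w arbitrary: \<Phi>)
  case (Cons c w)
  let ?u = "fst c" and ?a = "snd c" and ?us = "map fst w" and ?as = "map snd w"
  have shift: "(\<Sum>i=1..length (c # w). F i) = F 1 + (\<Sum>i<length w. F (Suc (Suc i)))"
    for F :: "nat \<Rightarrow> 'a"
    by (simp only: list.size sum.atLeast1_atMost_eq sum.lessThan_Suc_shift One_nat_def
        add_Suc_right add_0_right)
  have "(\<Sum>i=1..length (c # w). sgn_pow (eps (map fst (c # w)) (i - 1))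
        (\<Phi> ((map snd (c # w))[i - 1 := diff A (map snd (c # w) ! (i - 1))]))) =
      \<Phi> (diff A ?a # ?as) +
      (\<Sum>i<length w. sgn_pow (?u + 1 + eps ?us i) (\<Phi> (?a # ?as[i := diff A (?as ! i)])))"
    unfolding shift by (simp add: eps_Cons eps_0 sgn_pow_def)
  also have "(\<Sum>i<length w. sgn_pow (?u + 1 + eps ?us i) (\<Phi> (?a # ?as[i := diff A (?as ! i)]))) =
     sgn_pow (?u + 1) (\<Sum>i=1..length w. sgn_pow (eps ?us (i - 1))
        (\<Phi> (?a # ?as[i - 1 := diff A (?as ! (i - 1))])))"
    by (simp add: sum.atLeast1_atMost_eq sgn_pow_sum sgn_pow_sgn_pow)
  finally have 1: "(\<Sum>i=1..length (c # w). sgn_pow (eps (map fst (c # w)) (i - 1))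
        (\<Phi> ((map snd (c # w))[i - 1 := diff A (map snd (c # w) ! (i - 1))]))) =
      \<Phi> (diff A ?a # ?as) + \<dots>" .
  have 2: "(\<Sum>i=1..<length (c # w). sgn_pow (eps (map fst (c # w)) i)
        (\<Phi> (merge_at i (map snd (c # w))))) =
      sgn_pow (?u + 1) (merge_hd \<Phi> ?a ?as + (\<Sum>i=1..<length w. sgn_pow (eps ?us i)
        (\<Phi> (?a # merge_at i ?as))))"
  \<comment> \<open>A one-letter word has nothing to merge, in agreement with the value
    \<open>0\<close> of \<open>merge_hd\<close> at \<open>[]\<close>. Otherwise \<open>i = 1\<close>
    merges the first two letters and \<open>i > 1\<close> merges inside \<open>w\<close>.\<close>
  proof (cases w)
    case Nil
    then show ?thesis by (simp add: sgn_pow_def)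
  next
    case (Cons b w')
    have shift: "(\<Sum>i=1..<length (c # w). F i) = F 1 + (\<Sum>i=1..<length w. F (Suc i))"
      for F :: "nat \<Rightarrow> 'a"
    proof -
      have "(\<Sum>i=1..<length (c # w). F i) = F 1 + (\<Sum>i=Suc 1..<length (c # w). F i)"
        using Cons by (intro sum.atLeast_Suc_lessThan) simp
      also have "(\<Sum>i=Suc 1..<length (c # w). F i) = (\<Sum>i=1..<length w. F (Suc i))"
        using sum.shift_bounds_Suc_ivl[of F 1 "length w"] by simp
      finally show ?thesis .
    qed
    have "merge_at 1 (map snd (c # w)) = ?a * snd b # map snd w'"
      by (simp add: merge_at_def Cons)
    moreover have "sgn_pow (eps (map fst (c # w)) (Suc i)) (\<Phi> (merge_at (Suc i) (map snd (c # w)))) =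
        sgn_pow (?u + 1) (sgn_pow (eps ?us i) (\<Phi> (?a # merge_at i ?as)))" if "i \<in> {1..<length w}" for i
      using that by (cases i) (simp_all add: merge_at_def eps_Cons sgn_pow_sgn_pow)
    moreover have "eps (map fst (c # w)) 1 = ?u + 1"
      by (simp add: eps_def)
    moreover have "merge_hd \<Phi> ?a ?as = \<Phi> (?a * snd b # map snd w')"
      by (simp add: Cons)
    ultimately show ?thesis
      unfolding shift sgn_pow_add sgn_pow_sum by (simp only: cong: sum.cong)
  qed
  show ?case
    unfolding 1 2 by (simp add: Cons sgn_pow_add algebra_simps)
qed simp

text \<open>Induction on the weight through the first letter: terms inside the rest vanish by the
  induction hypothesis, and the differential of the first letter cancels the products of the first
  two letters by the twisting equation.\<close>

lemma sum_bar_diff_ts_word: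
  assumes "x \<in> TS A" "multiadditive \<Phi>"
  shows "(\<Sum>is\<in>compositions m. bar_diff \<Phi> (ts_word x is)) = 0"
  using assms(2)
proof (induction m arbitrary: \<Phi> rule: less_induct)
  case (less m)
  show ?case
  proof (cases "m = 0")
    case True
    then show ?thesis by (simp add: compositions_0)
  next
    case False
    \<comment> \<open>The first letter becomes part of the map, which is why \<open>\<Phi>\<close>
      is arbitrary in the induction.\<close>
    have IH: "(\<Sum>is\<in>compositions (m - i). bar_diff (\<lambda>as. \<Phi> (x i # as)) (ts_word x is)) = 0"
      if "i \<in> {1..m}" for i
      using that less.prems by (intro less.IH multiadditive_Cons) auto
    have twist: "\<Phi> (diff A (x n) # as) + \<Phi> ((\<Sum>i=1..<n. x i * x (n - i)) # as) = 0"
      if "n \<in> {1..m}" for n as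
      using that assms(1) additive.add[OF multiadditive_hd[OF less.prems]]
        additive.zero[OF multiadditive_hd[OF less.prems]]
      by (auto simp: TS_def simp flip: additive.add[OF multiadditive_hd[OF less.prems]])
    have "(\<Sum>is\<in>compositions m. bar_diff \<Phi> (ts_word x is)) =
        (\<Sum>i=1..m. \<Sum>is\<in>compositions (m - i). \<Phi> (diff A (x i) # map x is)) +
        (\<Sum>i=1..m. \<Sum>j=1..m - i. \<Sum>is\<in>compositions (m - i - j). \<Phi> (x i * x j # map x is))"
      using False IH
      by (simp add: sum_compositions sgn_pow_def sum.distrib sum_merge_hd_compositions)
    also have "\<dots> = 0"
      unfolding sum_mult_hd[OF less.prems] sum.distrib[symmetric]
      using twist by simp
    finally show ?thesis .
  qed
qed

lemma sum_merge_hd_homotopy_word: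
  "(\<Sum>t\<in>pointed_compositions m. merge_hd \<Phi> a (map snd (homotopy_word x' h x t))) =
   (\<Sum>j=1..m. \<Sum>vs\<in>compositions (m - j). \<Phi> (a * h j # map x vs)) +
   (\<Sum>j=1..m. \<Sum>t\<in>pointed_compositions (m - j).
      \<Phi> (a * x' j # map snd (homotopy_word x' h x t)))"
  by (subst sum_pointed_compositions) (simp add: homotopy_word_def case_prod_unfold)

text \<open>A telescoping sum. The homotopy equation turns \<open>d h\<close> and the products
  \<open>x' h\<close>, \<open>h x\<close> at the front into \<open>x n - x' n\<close> followed by
  letters \<open>x\<close>. For a leading \<open>x'\<close> the induction hypothesis gives
  \<open>x'\<close> before words in \<open>x\<close> minus \<open>x'\<close> before words in
  \<open>x'\<close>. The mixed words cancel.\<close>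

lemma sum_bar_diff_homotopy_word:
  assumes "x' \<in> TS A" "x \<in> TS A" "multiadditive \<Phi>"
    and h: "\<And>n. n \<ge> 1 \<Longrightarrow>
      x' n - x n + diff A (h n) + (\<Sum>i=1..<n. x' (n - i) * h i - h i * x (n - i)) = 0"
  shows "(\<Sum>t\<in>pointed_compositions m. bar_diff \<Phi> (homotopy_word x' h x t)) =
    (\<Sum>is\<in>compositions m. \<Phi> (map x is)) - (\<Sum>is\<in>compositions m. \<Phi> (map x' is))"
  using assms(3)
proof (induction m arbitrary: \<Phi> rule: less_induct)
  case (less m)
  note add = additive.add[OF multiadditive_hd[OF less.prems]]
  note diff = additive.diff[OF multiadditive_hd[OF less.prems]]
  note zero = additive.zero[OF multiadditive_hd[OF less.prems]]
  let ?w = "homotopy_word x' h x"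
  show ?case
  proof (cases "m = 0")
    case True
    \<comment> \<open>The letter \<open>h\<close> has positive index, so no pointed word has weight
      \<open>0\<close>; on the right both sums equal \<open>\<Phi> []\<close>.\<close>
    have "pointed_compositions 0 = {}" by (auto simp: pointed_compositions_def)
    then show ?thesis by (simp add: True compositions_0)
  next
    case False
    have IH: "(\<Sum>t\<in>pointed_compositions (m - u). bar_diff (\<lambda>as. \<Phi> (x' u # as)) (?w t)) =
        (\<Sum>is\<in>compositions (m - u). \<Phi> (x' u # map x is)) -
        (\<Sum>is\<in>compositions (m - u). \<Phi> (x' u # map x' is))"
      if "u \<in> {1..m}" for u
      using that less.prems by (intro less.IH multiadditive_Cons) auto
    have MC: "(\<Sum>vs\<in>compositions k. bar_diff (\<lambda>as. \<Phi> (h n # as)) (ts_word x vs)) = 0" for n k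
      using less.prems by (intro sum_bar_diff_ts_word assms multiadditive_Cons)
    have twist: "\<Phi> (diff A (x' n) # as) + \<Phi> ((\<Sum>i=1..<n. x' i * x' (n - i)) # as) = 0"
      if "n \<in> {1..m}" for n as
      using that assms(1) zero by (auto simp: TS_def simp flip: add)
    have gauge: "\<Phi> (diff A (h n) # as) + \<Phi> ((\<Sum>i=1..<n. x' i * h (n - i)) # as) -
        \<Phi> ((\<Sum>i=1..<n. h i * x (n - i)) # as) = \<Phi> (x n # as) - \<Phi> (x' n # as)"
      if "n \<in> {1..m}" for n as
    proof -
      have "(\<Sum>i=1..<n. x' i * h (n - i)) = (\<Sum>i=1..<n. x' (n - i) * h i)"
        by (rule sum.reindex_bij_witness[of _ "\<lambda>i. n - i" "\<lambda>i. n - i"]) auto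
      moreover have "diff A (h n) + (\<Sum>i=1..<n. x' (n - i) * h i) - (\<Sum>i=1..<n. h i * x (n - i))
          = x n - x' n"
        using h[of n] that by (simp add: sum_subtractf algebra_simps eq_neg_iff_add_eq_0)
      ultimately show ?thesis by (simp flip: add diff)
    qed
    have G: "(\<Sum>n=1..m. \<Sum>vs\<in>compositions (m - n). \<Phi> (diff A (h n) # map x vs) +
          \<Phi> ((\<Sum>i=1..<n. x' i * h (n - i)) # map x vs) -
          \<Phi> ((\<Sum>i=1..<n. h i * x (n - i)) # map x vs)) =
        (\<Sum>n=1..m. \<Sum>vs\<in>compositions (m - n). \<Phi> (x n # map x vs) - \<Phi> (x' n # map x vs))"
      by (intro sum.cong refl gauge)
    have T: "(\<Sum>u=1..m. \<Sum>t\<in>pointed_compositions (m - u). \<Phi> (diff A (x' u) # map snd (?w t)) +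
        \<Phi> ((\<Sum>i=1..<u. x' i * x' (u - i)) # map snd (?w t))) = 0"
      using twist by simp
    \<comment> \<open>Passing \<open>h\<close> changes the sign, so the products \<open>h x\<close>
      enter negatively; the bar differential of the tail sums to zero by \<open>MC\<close>.\<close>
    have H: "(\<Sum>n=1..m. \<Sum>vs\<in>compositions (m - n). bar_diff \<Phi> ((2 * int n, h n) # ts_word x vs)) =
        (\<Sum>n=1..m. \<Sum>vs\<in>compositions (m - n). \<Phi> (diff A (h n) # map x vs)) -
        (\<Sum>n=1..m. \<Sum>j=1..m - n. \<Sum>vs\<in>compositions (m - n - j). \<Phi> (h n * x j # map x vs))"
      using MC by (simp add: sgn_pow_def sum.distrib sum_subtractf sum_negf sum_merge_hd_compositions)
    have X: "(\<Sum>u=1..m. \<Sum>t\<in>pointed_compositions (m - u).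
           bar_diff \<Phi> ((2 * int u + 1, x' u) # ?w t)) =
        (\<Sum>u=1..m. \<Sum>t\<in>pointed_compositions (m - u). \<Phi> (diff A (x' u) # map snd (?w t))) +
        ((\<Sum>u=1..m. \<Sum>is\<in>compositions (m - u). \<Phi> (x' u # map x is)) -
         (\<Sum>u=1..m. \<Sum>is\<in>compositions (m - u). \<Phi> (x' u # map x' is))) +
        ((\<Sum>u=1..m. \<Sum>j=1..m - u. \<Sum>vs\<in>compositions (m - u - j). \<Phi> (x' u * h j # map x vs)) +
         (\<Sum>u=1..m. \<Sum>j=1..m - u. \<Sum>t\<in>pointed_compositions (m - u - j).
            \<Phi> (x' u * x' j # map snd (?w t))))"
      using IH by (simp add: sgn_pow_def sum.distrib sum_subtractf sum_merge_hd_homotopy_word)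
    have "(\<Sum>t\<in>pointed_compositions m. bar_diff \<Phi> (?w t)) =
        (\<Sum>n=1..m. \<Sum>vs\<in>compositions (m - n). bar_diff \<Phi> ((2 * int n, h n) # ts_word x vs)) +
        (\<Sum>u=1..m. \<Sum>t\<in>pointed_compositions (m - u).
           bar_diff \<Phi> ((2 * int u + 1, x' u) # ?w t))"
      by (subst sum_pointed_compositions) (simp add: homotopy_word_def case_prod_unfold)
    \<comment> \<open>\<open>T\<close> removes the terms with \<open>d x'\<close> and
      \<open>x' x'\<close>; with \<open>G\<close>, the words \<open>x' n\<close> followed by letters
      \<open>x\<close> occur with both signs.\<close>
    also have "\<dots> = (\<Sum>n=1..m. \<Sum>is\<in>compositions (m - n). \<Phi> (x n # map x is)) -
        (\<Sum>u=1..m. \<Sum>is\<in>compositions (m - u). \<Phi> (x' u # map x' is))"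
      using G T
      unfolding H X sum_mult_hd[OF less.prems, where S = compositions]
        sum_mult_hd[OF less.prems, where S = pointed_compositions and x = x' and y = x'
          and g = "\<lambda>t. map snd (?w t)"] sum.distrib sum_subtractf
      by (simp add: algebra_simps)
    finally show ?thesis
      using False by (simp add: sum_compositions)
  qed
qed

end

section \<open>Signs and degrees of words\<close>

text \<open>With the extra \<open>1\<close> in the exponent, cuts before \<open>h\<close> count
  negatively and cuts after it positively. They become the two products in the homotopy
  equation.\<close>

lemma sum_homotopy_word_split:
  fixes g :: "'a list \<Rightarrow> 'a list \<Rightarrow> 'b::ab_group_add" and x x' h :: "nat \<Rightarrow> 'a"
  defines "vals t \<equiv> map snd (homotopy_word x' h x t)"
  shows "(\<Sum>i\<le>length (vals t).
       sgn_pow (eps (map fst (homotopy_word x' h x t)) i + 1) (g (take i (vals t)) (drop i (vals t)))) =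
     (\<Sum>i\<le>length (snd (snd t)).
        g (vals (fst t, fst (snd t), take i (snd (snd t)))) (map x (drop i (snd (snd t))))) -
     (\<Sum>i\<le>length (fst t). g (map x' (take i (fst t))) (vals (drop i (fst t), snd t)))"
proof -
  obtain us n vs where t: "t = (us, n, vs)" by (cases t)
  define f where
    "f i = sgn_pow (eps (map fst (homotopy_word x' h x t)) i + 1) (g (take i (vals t)) (drop i (vals t)))"
    for i
  have vals: "vals (us, n, vs) = map x' us @ h n # map x vs" for us n vs
    by (simp add: vals_def homotopy_word_def)
  \<comment> \<open>With \<open>r\<close> letters before \<open>h\<close> and \<open>s\<close> after
    it there are \<open>r + s + 2\<close> cuts: the first \<open>r + 1\<close> lie before
    \<open>h\<close>, the others after it.\<close>
  have append: "(\<Sum>i\<le>r + s + 1. f i) = (\<Sum>i\<le>r. f i) + (\<Sum>i\<le>s. f (r + 1 + i))" for r s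
    by (induction s) (simp_all add: add.assoc)
  have left: "f i = - g (map x' (take i us)) (vals (drop i us, n, vs))" if "i \<le> length us" for i
    using that even_eps_homotopy_word[of i us vs x' h x n]
    by (simp add: f_def t vals sgn_pow_def take_map drop_map)
  have right: "f (length us + 1 + i) = g (vals (us, n, take i vs)) (map x (drop i vs))"
    if "i \<le> length vs" for i
    using that even_eps_homotopy_word[of "length us + 1 + i" us vs x' h x n]
    by (simp add: f_def t vals sgn_pow_def take_map drop_map)
  have "length (vals t) = length us + length vs + 1"
    by (simp add: t vals)
  then show ?thesis
    unfolding f_def[symmetric] using left right
    by (simp only: append t fst_conv snd_conv) (simp add: sum_negf)
qed

text \<open>When one of the two words has only even prefixes, as \<open>ts_word\<close> does, the
  sign of a product term depends only on the cut in the other word.\<close>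

lemma even_eps2:
  "even (eps vs j) \<Longrightarrow> even (eps2 us vs i j) \<longleftrightarrow> odd (eps us i)"
  "even (eps us i) \<Longrightarrow> even (eps us (length us)) \<Longrightarrow> even (eps2 us vs i j) \<longleftrightarrow> odd (eps vs j)"
  by (auto simp: eps2_def)

definition homogeneous_word :: "('a, 'm) dg_alg_scheme \<Rightarrow> 'a word \<Rightarrow> bool" where
  "homogeneous_word A w \<longleftrightarrow> (\<forall>(u, a) \<in> set w. a \<in> grading A u)"

lemma homogeneous_list_word:
  "homogeneous_word A w \<Longrightarrow> homogeneous_list A (map fst w) (map snd w)"
  by (induction w) (auto simp: homogeneous_list_def homogeneous_word_def)

lemma homogeneous_ts_word:
  "x \<in> TS A \<Longrightarrow> is \<in> compositions m \<Longrightarrow> homogeneous_word A (ts_word x is)"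
  by (auto simp: homogeneous_word_def ts_word_def TS_def compositions_def)

lemma homogeneous_homotopy_word:
  assumes "x' \<in> TS A" "x \<in> TS A" "\<And>n. n \<ge> 1 \<Longrightarrow> h n \<in> grading A (2 * int n)"
    "t \<in> pointed_compositions m"
  shows "homogeneous_word A (homotopy_word x' h x t)"
  using assms
  by (auto simp: homogeneous_word_def homotopy_word_def ts_word_def TS_def pointed_compositions_def)

lemma degree_ts_word:
  "is \<in> compositions m \<Longrightarrow>
   sum_list (map fst (ts_word x is)) - int (length is) = 2 * int m"
  unfolding compositions_def
\<comment> \<open>The identity holds for lists with arbitrary entries, so positivity is discarded
  before the induction.\<close>
proof (clarify, thin_tac "Ball _ _")
  show "sum_list (map fst (ts_word x is)) - int (length is) = 2 * int (sum_list is)"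
    by (induction "is") auto
qed

text \<open>The letter \<open>h\<close> contributes \<open>2n - 1\<close> in place of
  \<open>2n\<close>; with the \<open>1\<close> added in \<open>hopz_grading\<close>, values on
  pointed words land in the even degrees that a homotopy requires.\<close>

lemma degree_homotopy_word:
  assumes "t \<in> pointed_compositions m"
  shows "sum_list (map fst (homotopy_word x' h x t)) - int (length (homotopy_word x' h x t)) =
    2 * int m - 1"
proof -
  obtain us n vs where t: "t = (us, n, vs)" by (cases t)
  then have "us \<in> compositions (sum_list us)" "vs \<in> compositions (sum_list vs)"
    using assms by (auto simp: compositions_def pointed_compositions_def)
  from degree_ts_word[OF this(1), of x'] degree_ts_word[OF this(2), of x] show ?thesis
    using assms by (auto simp: t homotopy_word_def pointed_compositions_def)
qed

text \<open>Both end terms contain a value at \<open>0\<close>. This passes between Cauchy products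
  over words and the sums in \<open>TS\<close> and \<open>homotopic\<close>.\<close>

lemma cauchy_sum_mult_ends:
  fixes a b :: "nat \<Rightarrow> 'a::ring"
  assumes "a 0 = 0" "b 0 = 0"
  shows "(\<Sum>n\<le>k. a n * b (k - n)) = (\<Sum>n=1..<k. a n * b (k - n))"
proof (rule sum.mono_neutral_right)
  show "\<forall>n\<in>{..k} - {1..<k}. a n * b (k - n) = 0"
  proof
    fix n assume "n \<in> {..k} - {1..<k}"
    then have "n = 0 \<or> n = k" by auto
    then show "a n * b (k - n) = 0" using assms by auto
  qed
qed auto

section \<open>The product and homotopies\<close>

context hirsch_algebra
begin

definition hopz :: "'a list \<Rightarrow> 'a list \<Rightarrow> 'a" where
  \<comment> \<open>with the junk value of \<open>hop A [] []\<close> set to \<open>0\<close>, the product term of \<open>diff_hop\<close>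
    ranges over all \<open>(i, j)\<close>\<close>
  "hopz as bs = (if as = [] \<and> bs = [] then 0 else hop A as bs)"

lemma hopz_Nil: "hopz [] [] = 0"
  by (simp add: hopz_def)

lemma multiadditive_hopz_left: "multiadditive (\<lambda>as. hopz as bs)"
  unfolding multiadditive_def
proof (intro allI impI)
  fix i and as :: "'a list" assume i: "i < length as"
  then have "hopz (as[i := a]) bs = hop A (as[i := a]) bs" for a
    by (auto simp: hopz_def)
  then show "additive (\<lambda>a. hopz (as[i := a]) bs)"
    using hop_additive_left[OF i] by simp
qed

lemma multiadditive_hopz_right: "multiadditive (hopz as)"
  unfolding multiadditive_def
proof (intro allI impI)
  fix i and bs :: "'a list" assume i: "i < length bs"
  then have "hopz as (bs[i := b]) = hop A as (bs[i := b])" for b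
    by (auto simp: hopz_def)
  then show "additive (\<lambda>b. hopz as (bs[i := b]))"
    using hop_additive_right[OF i] by simp
qed

lemma hopz_grading:
  assumes "homogeneous_word A w" "homogeneous_word A v"
  shows "hopz (map snd w) (map snd v) \<in> grading A
    (sum_list (map fst w) - int (length w) + (sum_list (map fst v) - int (length v)) + 1)"
proof (cases "w = [] \<and> v = []")
  case False
  then show ?thesis
    using hop_grading[OF assms[THEN homogeneous_list_word]] by (auto simp: hopz_def algebra_simps)
qed (simp add: hopz_def grading_0)

text \<open>The Hirsch relation in bar form: the four sums with differentials and merges become two
  bar differentials, and the product sum covers the full rectangle of cuts.\<close>

lemma diff_hopz:
  assumes "homogeneous_word A w" "homogeneous_word A v"
  shows "diff A (hopz (map snd w) (map snd v)) =
    bar_diff (\<lambda>as. hopz as (map snd v)) w +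
    sgn_pow (eps (map fst w) (length w)) (bar_diff (hopz (map snd w)) v) +
    (\<Sum>i\<le>length w. \<Sum>j\<le>length v. sgn_pow (eps2 (map fst w) (map fst v) i j)
      (hopz (take i (map snd w)) (take j (map snd v)) * hopz (drop i (map snd w)) (drop j (map snd v))))"
proof (cases "w = [] \<and> v = []")
  case True
  then show ?thesis
    by (simp add: hopz_def sgn_pow_def additive.zero[OF diff_additive])
next
  case False
  let ?us = "map fst w" and ?as = "map snd w" and ?vs = "map fst v" and ?bs = "map snd v"
  let ?p = "length w" and ?q = "length v"
  \<comment> \<open>Neither merging nor replacing a letter empties a list, so \<open>hopz\<close>
    agrees with \<open>hop A\<close> in all these terms.\<close>
  have merge: "merge_at i as \<noteq> []" for i and as :: "'a list"
    by (simp add: merge_at_def)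
  have bl: "bar_diff (\<lambda>as. hopz as ?bs) w =
     (\<Sum>i=1..?p. sgn_pow (eps ?us (i - 1)) (hop A (?as[i - 1 := diff A (?as ! (i - 1))]) ?bs)) +
     (\<Sum>i=1..<?p. sgn_pow (eps ?us i) (hop A (merge_at i ?as) ?bs))"
    unfolding bar_diff_eq hopz_def by (intro arg_cong2[where f = "(+)"] sum.cong refl) (auto simp: merge)
  have br: "sgn_pow (eps ?us ?p) (bar_diff (hopz ?as) v) =
     (\<Sum>j=1..?q. sgn_pow (eps ?us ?p + eps ?vs (j - 1))
        (hop A ?as (?bs[j - 1 := diff A (?bs ! (j - 1))]))) +
     (\<Sum>j=1..<?q. sgn_pow (eps ?us ?p + eps ?vs j) (hop A ?as (merge_at j ?bs)))"
    unfolding bar_diff_eq hopz_def sgn_pow_add sgn_pow_sum sgn_pow_sgn_pow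
    by (intro arg_cong2[where f = "(+)"] sum.cong refl) (auto simp: merge)
  have "(\<Sum>i\<le>?p. \<Sum>j\<le>?q. sgn_pow (eps2 ?us ?vs i j)
      (hopz (take i ?as) (take j ?bs) * hopz (drop i ?as) (drop j ?bs))) =
    (\<Sum>(i, j) \<in> {0..?p} \<times> {0..?q}. sgn_pow (eps2 ?us ?vs i j)
      (hopz (take i ?as) (take j ?bs) * hopz (drop i ?as) (drop j ?bs)))"
    by (simp add: sum.cartesian_product atLeast0AtMost)
  \<comment> \<open>At each of the two removed corners one factor is \<open>hopz [] []\<close>,
    which is \<open>0\<close>.\<close>
  also have "\<dots> = (\<Sum>(i, j) \<in> {0..?p} \<times> {0..?q} - {(0, 0), (?p, ?q)}. sgn_pow (eps2 ?us ?vs i j)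
      (hopz (take i ?as) (take j ?bs) * hopz (drop i ?as) (drop j ?bs)))"
    by (rule sum.mono_neutral_right) (auto simp: hopz_Nil sgn_pow_zero)
  also have "\<dots> = (\<Sum>(i, j) \<in> {0..?p} \<times> {0..?q} - {(0, 0), (?p, ?q)}. sgn_pow (eps2 ?us ?vs i j)
      (hop A (take i ?as) (take j ?bs) * hop A (drop i ?as) (drop j ?bs)))"
  proof (rule sum.cong[OF refl], rule prod.case_cong[OF refl])
    fix z i j
    assume "z \<in> {0..?p} \<times> {0..?q} - {(0, 0), (?p, ?q)}" "z = (i, j)"
    then have "\<not> (take i ?as = [] \<and> take j ?bs = [])" "\<not> (drop i ?as = [] \<and> drop j ?bs = [])"
      by auto
    then show "sgn_pow (eps2 ?us ?vs i j)
        (hopz (take i ?as) (take j ?bs) * hopz (drop i ?as) (drop j ?bs)) =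
      sgn_pow (eps2 ?us ?vs i j)
        (hop A (take i ?as) (take j ?bs) * hop A (drop i ?as) (drop j ?bs))"
      by (simp only: hopz_def if_False)
  qed
  finally have pr: "(\<Sum>i\<le>?p. \<Sum>j\<le>?q. sgn_pow (eps2 ?us ?vs i j)
      (hopz (take i ?as) (take j ?bs) * hopz (drop i ?as) (drop j ?bs))) = \<dots>" .
  have "?p + ?q \<ge> 1" using False by (cases w; cases v) auto
  moreover have "hopz ?as ?bs = hop A ?as ?bs" using False by (auto simp: hopz_def)
  ultimately show ?thesis
    using diff_hop[OF assms[THEN homogeneous_list_word], of ?p ?q]
    unfolding bl br pr by (simp add: algebra_simps)
qed

section \<open>The product of twisting sequences\<close>

text \<open>Summing over all pairs of words adds at most the empty pair, on which
  \<open>hopz\<close> vanishes.\<close>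

lemma mu_eq_cauchy_sum:
  "mu A x y = cauchy_sum compositions compositions (\<lambda>is js. hopz (map x is) (map y js))"
proof
  fix k
  let ?I = "{(is, js). (\<forall>i \<in> set is \<union> set js. i \<ge> (1::nat)) \<and> sum_list is + sum_list js = k}"
  let ?F = "\<lambda>is js. hopz (map x is) (map y js)"
  have "cauchy_sum compositions compositions ?F k =
    (\<Sum>(a, is, js) \<in> Sigma {..k} (\<lambda>a. compositions a \<times> compositions (k - a)). ?F is js)"
    by (simp add: cauchy_sum_def sum.Sigma finite_compositions sum.cartesian_product)
  also have "\<dots> = (\<Sum>(is, js) \<in> ?I. ?F is js)"
    by (rule sum.reindex_bij_witness[of _ "\<lambda>(is, js). (sum_list is, is, js)" "\<lambda>(a, is, js). (is, js)"])
      (auto simp: compositions_def)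
  also have "\<dots> = (\<Sum>(is, js) \<in> mu_index k. ?F is js)"
  proof (rule sum.mono_neutral_right)
    have "?I \<subseteq> insert ([], []) (mu_index k)" by (auto simp: mu_index_def)
    then show "finite ?I" by (rule finite_subset) (simp add: finite_mu_index)
  qed (auto simp: mu_index_def hopz_def)
  also have "\<dots> = mu A x y k"
    unfolding mu_def by (rule sum.cong) (auto simp: mu_index_def hopz_def)
  finally show "mu A x y k = cauchy_sum compositions compositions ?F k" by simp
qed

lemma mu_mult:
  "(\<Sum>n\<le>k. mu A x y n * mu A x y (k - n)) =
   cauchy_sum compositions compositions (\<lambda>is js. \<Sum>i\<le>length is. \<Sum>j\<le>length js.
     hopz (map x (take i is)) (map y (take j js)) * hopz (map x (drop i is)) (map y (drop j js))) k"
  unfolding mu_eq_cauchy_sum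
  by (rule cauchy_sum_mult_split[symmetric]; rule sum_compositions_split)

text \<open>All prefixes are even, so both bar differentials enter positively and the
  \<open>1\<close> in \<open>eps2\<close> makes every product negative.\<close>

lemma diff_hopz_ts_words:
  assumes "x \<in> TS A" "y \<in> TS A" "is \<in> compositions a" "js \<in> compositions b"
  shows "diff A (hopz (map x is) (map y js)) =
    bar_diff (\<lambda>as. hopz as (map y js)) (ts_word x is) + bar_diff (hopz (map x is)) (ts_word y js) -
    (\<Sum>i\<le>length is. \<Sum>j\<le>length js.
     hopz (map x (take i is)) (map y (take j js)) * hopz (map x (drop i is)) (map y (drop j js)))"
  using diff_hopz[OF homogeneous_ts_word[OF assms(1,3)] homogeneous_ts_word[OF assms(2,4)]]
  by (simp add: sgn_pow_def even_eps2 even_eps_ts_word take_map drop_map sum_negf)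

lemma mu_in_TS:
  assumes "x \<in> TS A" "y \<in> TS A"
  shows "mu A x y \<in> TS A"
  unfolding TS_def
proof (intro CollectI conjI allI impI mu_0)
  fix n :: nat assume n: "n \<ge> 1"
  interpret D: additive "diff A" by (rule diff_additive)
  show "mu A x y n \<in> grading A (2 * int n + 1)"
    unfolding mu_eq_cauchy_sum cauchy_sum_def
  proof (intro grading_sum)
    fix a "is" js assume a: "a \<in> {..n}" "is \<in> compositions a" "js \<in> compositions (n - a)"
    show "hopz (map x is) (map y js) \<in> grading A (2 * int n + 1)"
      using hopz_grading[OF homogeneous_ts_word[OF assms(1) a(2)] homogeneous_ts_word[OF assms(2) a(3)]]
        degree_ts_word[OF a(2), of x] degree_ts_word[OF a(3), of y] a(1) by (simp add: of_nat_diff)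
  qed
  have "diff A (mu A x y n) = (\<Sum>a\<le>n. \<Sum>is\<in>compositions a. \<Sum>js\<in>compositions (n - a).
      diff A (hopz (map x is) (map y js)))"
    by (simp add: mu_eq_cauchy_sum cauchy_sum_def D.sum)
  also have "\<dots> =
    (\<Sum>a\<le>n. \<Sum>is\<in>compositions a. \<Sum>js\<in>compositions (n - a).
       bar_diff (\<lambda>as. hopz as (map y js)) (ts_word x is)) +
    (\<Sum>a\<le>n. \<Sum>is\<in>compositions a. \<Sum>js\<in>compositions (n - a).
       bar_diff (hopz (map x is)) (ts_word y js)) - (\<Sum>i\<le>n. mu A x y i * mu A x y (n - i))"
    unfolding mu_mult cauchy_sum_def sum.distrib[symmetric] sum_subtractf[symmetric]
    by (intro sum.cong refl diff_hopz_ts_words[OF assms])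
  also have "(\<Sum>a\<le>n. \<Sum>is\<in>compositions a. \<Sum>js\<in>compositions (n - a).
       bar_diff (\<lambda>as. hopz as (map y js)) (ts_word x is)) = 0"
    \<comment> \<open>The sum over \<open>is\<close> moves innermost; for fixed \<open>js\<close> it
      is then a vanishing sum of bar differentials.\<close>
    by (subst sum.swap[of _ "compositions (_ - _)"])
      (simp add: sum_bar_diff_ts_word[OF assms(1) multiadditive_hopz_left])
  also have "(\<Sum>a\<le>n. \<Sum>is\<in>compositions a. \<Sum>js\<in>compositions (n - a).
       bar_diff (hopz (map x is)) (ts_word y js)) = 0"
    by (simp add: sum_bar_diff_ts_word[OF assms(2) multiadditive_hopz_right])
  also have "(\<Sum>i\<le>n. mu A x y i * mu A x y (n - i)) = (\<Sum>i=1..<n. mu A x y i * mu A x y (n - i))"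
    by (intro cauchy_sum_mult_ends mu_0)
  finally show "diff A (mu A x y n) + (\<Sum>i=1..<n. mu A x y i * mu A x y (n - i)) = 0"
    by simp
qed

section \<open>Homotopy invariance of the product\<close>

text \<open>The whole pointed word is odd, so moving the bar differential past it to the second
  group costs a sign.\<close>

lemma diff_hopz_homotopy_word_left:
  fixes x x' h :: "nat \<Rightarrow> 'a"
  assumes "x' \<in> TS A" "x \<in> TS A" "y \<in> TS A" "\<And>n. n \<ge> 1 \<Longrightarrow> h n \<in> grading A (2 * int n)"
    "t \<in> pointed_compositions a" "js \<in> compositions b"
  defines "vals s \<equiv> map snd (homotopy_word x' h x s)"
  shows "diff A (hopz (vals t) (map y js)) =
    bar_diff (\<lambda>as. hopz as (map y js)) (homotopy_word x' h x t) -
    bar_diff (hopz (vals t)) (ts_word y js) +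
    (\<Sum>i\<le>length (snd (snd t)). \<Sum>j\<le>length js.
        hopz (vals (fst t, fst (snd t), take i (snd (snd t)))) (map y (take j js)) *
        hopz (map x (drop i (snd (snd t)))) (map y (drop j js))) -
    (\<Sum>i\<le>length (fst t). \<Sum>j\<le>length js.
        hopz (map x' (take i (fst t))) (map y (take j js)) *
        hopz (vals (drop i (fst t), snd t)) (map y (drop j js)))"
proof -
  let ?w = "homotopy_word x' h x t"
  have odd: "odd (eps (map fst ?w) (length ?w))"
    using even_eps_homotopy_word[of "length ?w" "fst t" "snd (snd t)" x' h x "fst (snd t)"]
    by (simp add: homotopy_word_def case_prod_unfold)
  have "(\<Sum>i\<le>length ?w. \<Sum>j\<le>length js. sgn_pow (eps2 (map fst ?w) (map fst (ts_word y js)) i j)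
      (hopz (take i (vals t)) (take j (map y js)) * hopz (drop i (vals t)) (drop j (map y js)))) =
    (\<Sum>i\<le>length (vals t). sgn_pow (eps (map fst ?w) i + 1) (\<Sum>j\<le>length js.
      hopz (take i (vals t)) (map y (take j js)) * hopz (drop i (vals t)) (map y (drop j js))))"
    unfolding sgn_pow_sum vals_def length_map
    by (intro sum.cong refl) (simp add: sgn_pow_def even_eps2 even_eps_ts_word take_map drop_map)
  also note sum_homotopy_word_split[of x' h x t "\<lambda>as as'. \<Sum>j\<le>length js.
      hopz as (map y (take j js)) * hopz as' (map y (drop j js))", folded vals_def]
  finally show ?thesis
    using diff_hopz[OF homogeneous_homotopy_word[OF assms(1,2,4,5)] homogeneous_ts_word[OF assms(3,6)]] odd
    by (simp add: vals_def sgn_pow_def)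
qed

text \<open>Now the first group is an ordinary, even word, so the second bar differential keeps its
  sign; the products are signed by the cut of the pointed word alone.\<close>

lemma diff_hopz_homotopy_word_right:
  fixes x x' h :: "nat \<Rightarrow> 'a"
  assumes "x' \<in> TS A" "x \<in> TS A" "y \<in> TS A" "\<And>n. n \<ge> 1 \<Longrightarrow> h n \<in> grading A (2 * int n)"
    "is \<in> compositions a" "t \<in> pointed_compositions b"
  defines "vals s \<equiv> map snd (homotopy_word x' h x s)"
  shows "diff A (hopz (map y is) (vals t)) =
    bar_diff (\<lambda>as. hopz as (vals t)) (ts_word y is) +
    bar_diff (hopz (map y is)) (homotopy_word x' h x t) +
    (\<Sum>i\<le>length is. \<Sum>j\<le>length (snd (snd t)).
        hopz (map y (take i is)) (vals (fst t, fst (snd t), take j (snd (snd t)))) *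
        hopz (map y (drop i is)) (map x (drop j (snd (snd t))))) -
    (\<Sum>i\<le>length is. \<Sum>j\<le>length (fst t).
        hopz (map y (take i is)) (map x' (take j (fst t))) *
        hopz (map y (drop i is)) (vals (drop j (fst t), snd t)))"
proof -
  let ?w = "homotopy_word x' h x t"
  have "(\<Sum>i\<le>length is. \<Sum>j\<le>length ?w. sgn_pow (eps2 (map fst (ts_word y is)) (map fst ?w) i j)
      (hopz (take i (map y is)) (take j (vals t)) * hopz (drop i (map y is)) (drop j (vals t)))) =
    (\<Sum>i\<le>length is. \<Sum>j\<le>length (vals t). sgn_pow (eps (map fst ?w) j + 1)
      (hopz (map y (take i is)) (take j (vals t)) * hopz (map y (drop i is)) (drop j (vals t))))"
    by (simp add: sgn_pow_def even_eps2 even_eps_ts_word take_map drop_map vals_def)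
  also have "\<dots> = (\<Sum>i\<le>length is. (\<Sum>j\<le>length (snd (snd t)).
        hopz (map y (take i is)) (vals (fst t, fst (snd t), take j (snd (snd t)))) *
        hopz (map y (drop i is)) (map x (drop j (snd (snd t))))) -
    (\<Sum>j\<le>length (fst t).
        hopz (map y (take i is)) (map x' (take j (fst t))) *
        hopz (map y (drop i is)) (vals (drop j (fst t), snd t))))"
    unfolding vals_def
    by (intro sum.cong refl sum_homotopy_word_split[of x' h x t
        "\<lambda>bs bs'. hopz (map y (take _ is)) bs * hopz (map y (drop _ is)) bs'"])
  finally show ?thesis
    using diff_hopz[OF homogeneous_ts_word[OF assms(3,5)] homogeneous_homotopy_word[OF assms(1,2,4,6)]]
    by (simp add: vals_def sgn_pow_def even_eps_ts_word sum_subtractf)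
qed

text \<open>The homotopy equation solved for \<open>diff A (H n)\<close> with full Cauchy products,
  whose end terms vanish because all three sequences are \<open>0\<close> at
  \<open>0\<close>.\<close>

lemma homotopicI:
  assumes "\<And>n. n \<ge> 1 \<Longrightarrow> H n \<in> grading A (2 * int n)" "H 0 = 0" "x 0 = 0" "y 0 = 0"
    and "\<And>n. n \<ge> 1 \<Longrightarrow> diff A (H n) =
      x n - y n + (\<Sum>i\<le>n. H i * x (n - i)) - (\<Sum>i\<le>n. y i * H (n - i))"
  shows "homotopic A x y"
  unfolding homotopic_def
proof (intro exI[of _ H] allI impI conjI assms(1))
  fix n :: nat assume n: "n \<ge> 1"
  have "(\<Sum>i=1..<n. y i * H (n - i)) = (\<Sum>i=1..<n. y (n - i) * H i)"
    by (rule sum.reindex_bij_witness[of _ "\<lambda>i. n - i" "\<lambda>i. n - i"]) auto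
  then show "y n - x n + diff A (H n) + (\<Sum>i=1..<n. y (n - i) * H i - H i * x (n - i)) = 0"
    using assms(2-5) n by (simp add: cauchy_sum_mult_ends sum_subtractf)
qed

lemma mu_homotopic_left:
  assumes "x \<in> TS A" "x' \<in> TS A" "y \<in> TS A" "homotopic A x x'"
  shows "homotopic A (mu A x y) (mu A x' y)"
proof -
  interpret D: additive "diff A" by (rule diff_additive)
  obtain h where h: "\<And>n. n \<ge> 1 \<Longrightarrow> h n \<in> grading A (2 * int n)"
    "\<And>n. n \<ge> 1 \<Longrightarrow>
       x' n - x n + diff A (h n) + (\<Sum>i=1..<n. x' (n - i) * h i - h i * x (n - i)) = 0"
    using assms(4) unfolding homotopic_def by blast
  define vals where "vals t = map snd (homotopy_word x' h x t)" for t
  define H where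
    "H = cauchy_sum pointed_compositions compositions (\<lambda>t js. hopz (vals t) (map y js))"
  show ?thesis
  proof (rule homotopicI)
    have "pointed_compositions 0 = {}" by (auto simp: pointed_compositions_def)
    then show "H 0 = 0" by (simp add: H_def cauchy_sum_def)
  next
    fix n :: nat assume n: "n \<ge> 1"
    show "H n \<in> grading A (2 * int n)"
      unfolding H_def cauchy_sum_def
    proof (intro grading_sum)
      fix a t js assume a: "a \<in> {..n}" "t \<in> pointed_compositions a" "js \<in> compositions (n - a)"
      show "hopz (vals t) (map y js) \<in> grading A (2 * int n)"
        using hopz_grading[OF homogeneous_homotopy_word[OF assms(2,1) h(1) a(2)]
            homogeneous_ts_word[OF assms(3) a(3)]]
          degree_homotopy_word[OF a(2), of x' h x] degree_ts_word[OF a(3), of y] a(1)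
        by (simp add: vals_def of_nat_diff)
    qed
    have "diff A (H n) = (\<Sum>a\<le>n. \<Sum>t\<in>pointed_compositions a. \<Sum>js\<in>compositions (n - a).
        diff A (hopz (vals t) (map y js)))"
      by (simp add: H_def cauchy_sum_def D.sum)
    also have "\<dots> =
      (\<Sum>a\<le>n. \<Sum>t\<in>pointed_compositions a. \<Sum>js\<in>compositions (n - a).
         bar_diff (\<lambda>as. hopz as (map y js)) (homotopy_word x' h x t)) -
      (\<Sum>a\<le>n. \<Sum>t\<in>pointed_compositions a. \<Sum>js\<in>compositions (n - a).
         bar_diff (hopz (vals t)) (ts_word y js)) +
      cauchy_sum pointed_compositions compositions (\<lambda>t js.
        \<Sum>i\<le>length (snd (snd t)). \<Sum>j\<le>length js.
          hopz (vals (fst t, fst (snd t), take i (snd (snd t)))) (map y (take j js)) *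
          hopz (map x (drop i (snd (snd t)))) (map y (drop j js))) n -
      cauchy_sum pointed_compositions compositions (\<lambda>t js.
        \<Sum>i\<le>length (fst t). \<Sum>j\<le>length js.
          hopz (map x' (take i (fst t))) (map y (take j js)) *
          hopz (vals (drop i (fst t), snd t)) (map y (drop j js))) n"
      unfolding cauchy_sum_def sum.distrib[symmetric] sum_subtractf[symmetric] vals_def
      by (intro sum.cong refl diff_hopz_homotopy_word_left assms h(1))
    \<comment> \<open>For fixed \<open>js\<close> the pointed words telescope to words in
      \<open>x\<close> minus words in \<open>x'\<close>.\<close>
    also have "(\<Sum>a\<le>n. \<Sum>t\<in>pointed_compositions a. \<Sum>js\<in>compositions (n - a).
         bar_diff (\<lambda>as. hopz as (map y js)) (homotopy_word x' h x t)) = mu A x y n - mu A x' y n"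
      unfolding mu_eq_cauchy_sum cauchy_sum_def
      by (subst (1 2 3) sum.swap[of _ "compositions (_ - _)"])
        (simp add: sum_bar_diff_homotopy_word[OF assms(2,1) multiadditive_hopz_left h(2)]
          sum_subtractf)
    also have "(\<Sum>a\<le>n. \<Sum>t\<in>pointed_compositions a. \<Sum>js\<in>compositions (n - a).
         bar_diff (hopz (vals t)) (ts_word y js)) = 0"
      by (simp add: sum_bar_diff_ts_word[OF assms(3) multiadditive_hopz_right])
    \<comment> \<open>Cuts after \<open>h\<close> leave an ordinary pair of words on the right,
      hence the factor \<open>mu A x y\<close>.\<close>
    also have "cauchy_sum pointed_compositions compositions (\<lambda>t js.
        \<Sum>i\<le>length (snd (snd t)). \<Sum>j\<le>length js.
          hopz (vals (fst t, fst (snd t), take i (snd (snd t)))) (map y (take j js)) *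
          hopz (map x (drop i (snd (snd t)))) (map y (drop j js))) n =
        (\<Sum>i\<le>n. H i * mu A x y (n - i))"
      unfolding H_def mu_eq_cauchy_sum
      by (rule cauchy_sum_mult_split
          [OF sum_pointed_compositions_split_right sum_compositions_split])
    \<comment> \<open>Cuts before \<open>h\<close> leave words in \<open>x'\<close> on the left,
      hence the factor \<open>mu A x' y\<close>.\<close>
    also have "cauchy_sum pointed_compositions compositions (\<lambda>t js.
        \<Sum>i\<le>length (fst t). \<Sum>j\<le>length js.
          hopz (map x' (take i (fst t))) (map y (take j js)) *
          hopz (vals (drop i (fst t), snd t)) (map y (drop j js))) n =
        (\<Sum>i\<le>n. mu A x' y i * H (n - i))"
      unfolding H_def mu_eq_cauchy_sum
      by (rule cauchy_sum_mult_split
          [OF sum_pointed_compositions_split_left sum_compositions_split])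
    finally show "diff A (H n) = mu A x y n - mu A x' y n +
        (\<Sum>i\<le>n. H i * mu A x y (n - i)) - (\<Sum>i\<le>n. mu A x' y i * H (n - i))"
      by simp
  qed (rule mu_0)+
qed

text \<open>The mirror image, with the pointed word among the second arguments.\<close>

lemma mu_homotopic_right:
  assumes "x \<in> TS A" "x' \<in> TS A" "y \<in> TS A" "homotopic A x x'"
  shows "homotopic A (mu A y x) (mu A y x')"
proof -
  interpret D: additive "diff A" by (rule diff_additive)
  obtain h where h: "\<And>n. n \<ge> 1 \<Longrightarrow> h n \<in> grading A (2 * int n)"
    "\<And>n. n \<ge> 1 \<Longrightarrow>
       x' n - x n + diff A (h n) + (\<Sum>i=1..<n. x' (n - i) * h i - h i * x (n - i)) = 0"
    using assms(4) unfolding homotopic_def by blast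
  define vals where "vals t = map snd (homotopy_word x' h x t)" for t
  define H where
    "H = cauchy_sum compositions pointed_compositions (\<lambda>is t. hopz (map y is) (vals t))"
  show ?thesis
  proof (rule homotopicI)
    have "pointed_compositions 0 = {}" by (auto simp: pointed_compositions_def)
    then show "H 0 = 0" by (simp add: H_def cauchy_sum_def)
  next
    fix n :: nat assume n: "n \<ge> 1"
    show "H n \<in> grading A (2 * int n)"
      unfolding H_def cauchy_sum_def
    proof (intro grading_sum)
      fix a "is" t assume a: "a \<in> {..n}" "is \<in> compositions a" "t \<in> pointed_compositions (n - a)"
      show "hopz (map y is) (vals t) \<in> grading A (2 * int n)"
        using hopz_grading[OF homogeneous_ts_word[OF assms(3) a(2)]
            homogeneous_homotopy_word[OF assms(2,1) h(1) a(3)]]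
          degree_homotopy_word[OF a(3), of x' h x] degree_ts_word[OF a(2), of y] a(1)
        by (simp add: vals_def of_nat_diff)
    qed
    have "diff A (H n) = (\<Sum>a\<le>n. \<Sum>is\<in>compositions a. \<Sum>t\<in>pointed_compositions (n - a).
        diff A (hopz (map y is) (vals t)))"
      by (simp add: H_def cauchy_sum_def D.sum)
    also have "\<dots> =
      (\<Sum>a\<le>n. \<Sum>is\<in>compositions a. \<Sum>t\<in>pointed_compositions (n - a).
         bar_diff (\<lambda>as. hopz as (vals t)) (ts_word y is)) +
      (\<Sum>a\<le>n. \<Sum>is\<in>compositions a. \<Sum>t\<in>pointed_compositions (n - a).
         bar_diff (hopz (map y is)) (homotopy_word x' h x t)) +
      cauchy_sum compositions pointed_compositions (\<lambda>is t.
        \<Sum>i\<le>length is. \<Sum>j\<le>length (snd (snd t)).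
          hopz (map y (take i is)) (vals (fst t, fst (snd t), take j (snd (snd t)))) *
          hopz (map y (drop i is)) (map x (drop j (snd (snd t))))) n -
      cauchy_sum compositions pointed_compositions (\<lambda>is t.
        \<Sum>i\<le>length is. \<Sum>j\<le>length (fst t).
          hopz (map y (take i is)) (map x' (take j (fst t))) *
          hopz (map y (drop i is)) (vals (drop j (fst t), snd t))) n"
      unfolding cauchy_sum_def sum.distrib[symmetric] sum_subtractf[symmetric] vals_def
      by (intro sum.cong refl diff_hopz_homotopy_word_right assms h(1))
    also have "(\<Sum>a\<le>n. \<Sum>is\<in>compositions a. \<Sum>t\<in>pointed_compositions (n - a).
         bar_diff (\<lambda>as. hopz as (vals t)) (ts_word y is)) = 0"
      by (subst sum.swap[of _ "pointed_compositions (_ - _)"])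
        (simp add: sum_bar_diff_ts_word[OF assms(3) multiadditive_hopz_left])
    also have "(\<Sum>a\<le>n. \<Sum>is\<in>compositions a. \<Sum>t\<in>pointed_compositions (n - a).
         bar_diff (hopz (map y is)) (homotopy_word x' h x t)) = mu A y x n - mu A y x' n"
      unfolding mu_eq_cauchy_sum cauchy_sum_def
      by (simp add: sum_bar_diff_homotopy_word[OF assms(2,1) multiadditive_hopz_right h(2)]
          sum_subtractf)
    also have "cauchy_sum compositions pointed_compositions (\<lambda>is t.
        \<Sum>i\<le>length is. \<Sum>j\<le>length (snd (snd t)).
          hopz (map y (take i is)) (vals (fst t, fst (snd t), take j (snd (snd t)))) *
          hopz (map y (drop i is)) (map x (drop j (snd (snd t))))) n =
        (\<Sum>i\<le>n. H i * mu A y x (n - i))"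
      unfolding H_def mu_eq_cauchy_sum
      by (rule cauchy_sum_mult_split
          [OF sum_compositions_split sum_pointed_compositions_split_right])
    also have "cauchy_sum compositions pointed_compositions (\<lambda>is t.
        \<Sum>i\<le>length is. \<Sum>j\<le>length (fst t).
          hopz (map y (take i is)) (map x' (take j (fst t))) *
          hopz (map y (drop i is)) (vals (drop j (fst t), snd t))) n =
        (\<Sum>i\<le>n. mu A y x' i * H (n - i))"
      unfolding H_def mu_eq_cauchy_sum
      by (rule cauchy_sum_mult_split
          [OF sum_compositions_split sum_pointed_compositions_split_left])
    finally show "diff A (H n) = mu A y x n - mu A y x' n +
        (\<Sum>i\<le>n. H i * mu A y x (n - i)) - (\<Sum>i\<le>n. mu A y x' i * H (n - i))"
      by simp
  qed (rule mu_0)+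
qed

text \<open>One argument is changed at a time, passing through \<open>mu A x' y\<close>.\<close>

lemma mu_respects_homotopy:
  assumes "(x, x') \<in> homotopy_rel A" "(y, y') \<in> homotopy_rel A"
  shows "(mu A x y, mu A x' y') \<in> homotopy_rel A"
proof -
  have "x \<in> TS A" "x' \<in> TS A" "homotopic A x x'" "y \<in> TS A" "y' \<in> TS A" "homotopic A y y'"
    using assms by (auto simp: homotopy_rel_def)
  then have "(mu A x y, mu A x' y) \<in> homotopy_rel A" "(mu A x' y, mu A x' y') \<in> homotopy_rel A"
    by (auto simp: homotopy_rel_def intro: mu_in_TS mu_homotopic_left mu_homotopic_right)
  then show ?thesis
    using equiv_homotopy_rel by (meson equivE transE)
qed

section \<open>The unit laws\<close>

lemma zero_in_TS: "(\<lambda>_. 0) \<in> TS A"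
  by (simp add: TS_def grading_0 additive.zero[OF diff_additive])

lemma hop_zero_left:
  assumes "0 \<in> set as"
  shows "hop A as bs = 0"
proof -
  obtain i where "i < length as" "as ! i = 0"
    using assms by (auto simp: in_set_conv_nth)
  then show ?thesis
    using additive.zero[OF hop_additive_left, of i as bs] by (metis list_update_id)
qed

lemma hop_zero_right:
  assumes "0 \<in> set bs"
  shows "hop A as bs = 0"
proof -
  obtain j where "j < length bs" "bs ! j = 0"
    using assms by (auto simp: in_set_conv_nth)
  then show ?thesis
    using additive.zero[OF hop_additive_right, of j bs as] by (metis list_update_id)
qed

text \<open>For \<open>k > 0\<close> only the pair \<open>([], [k])\<close> survives: a nonempty
  first list feeds a zero into \<open>hop A\<close>, and with an empty first list
  \<open>hop_0_p\<close> kills the longer second lists.\<close>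

lemma mu_zero_left:
  assumes "x 0 = 0"
  shows "mu A (\<lambda>_. 0) x = x"
proof
  fix k
  show "mu A (\<lambda>_. 0) x k = x k"
  proof (cases "k = 0")
    case False
    have "mu A (\<lambda>_. 0) x k = (\<Sum>(is, js)\<in>{([] :: nat list, [k])}. hop A (map (\<lambda>_. 0) is) (map x js))"
      unfolding mu_def
    proof (intro sum.mono_neutral_right finite_mu_index ballI)
      fix p assume "p \<in> mu_index k - {([], [k])}"
      moreover obtain "is" js where p: "p = (is, js)" by (cases p)
      ultimately consider "is \<noteq> []" | "is = []" "length js > 1"
        by (cases "is"; cases js; cases "tl js") (auto simp: mu_index_def)
      then have "hop A (map (\<lambda>_. 0) is) (map x js) = 0"
      proof cases
        case 1
        then show ?thesis by (intro hop_zero_left) (cases "is"; simp)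
      next
        case 2
        then show ?thesis by (simp add: hop_0_p)
      qed
      then show "(case p of (is, js) \<Rightarrow> hop A (map (\<lambda>_. 0) is) (map x js)) = 0"
        by (simp add: p)
    qed (use False in \<open>auto simp: mu_index_def\<close>)
    then show ?thesis by (simp add: hop_0_1)
  qed (simp add: assms mu_0)
qed

lemma mu_zero_right:
  assumes "x 0 = 0"
  shows "mu A x (\<lambda>_. 0) = x"
proof
  fix k
  show "mu A x (\<lambda>_. 0) k = x k"
  proof (cases "k = 0")
    case False
    have "mu A x (\<lambda>_. 0) k = (\<Sum>(is, js)\<in>{([k], [] :: nat list)}. hop A (map x is) (map (\<lambda>_. 0) js))"
      unfolding mu_def
    proof (intro sum.mono_neutral_right finite_mu_index ballI)
      fix p assume "p \<in> mu_index k - {([k], [])}"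
      moreover obtain "is" js where p: "p = (is, js)" by (cases p)
      ultimately consider "js \<noteq> []" | "js = []" "length is > 1"
        by (cases js; cases "is"; cases "tl is") (auto simp: mu_index_def)
      then have "hop A (map x is) (map (\<lambda>_. 0) js) = 0"
      proof cases
        case 1
        then show ?thesis by (intro hop_zero_right) (cases js; simp)
      next
        case 2
        then show ?thesis by (simp add: hop_p_0)
      qed
      then show "(case p of (is, js) \<Rightarrow> hop A (map x is) (map (\<lambda>_. 0) js)) = 0"
        by (simp add: p)
    qed (use False in \<open>auto simp: mu_index_def\<close>)
    then show ?thesis by (simp add: hop_1_0)
  qed (simp add: assms mu_0)
qed

end

section \<open>Naturality and the product on homotopy classes\<close>

lemma hirsch_map_TS:
  assumes "hirsch_map A B f" "x \<in> TS A"
  shows "f \<circ> x \<in> TS B"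
proof -
  interpret f: additive f using assms(1) by (simp add: hirsch_map_def)
  have *: "f (a * b) = f a * f b" "a \<in> grading A n \<Longrightarrow> f a \<in> grading B n"
    "diff B (f a) = f (diff A a)" for a b n
    using assms(1) by (auto simp: hirsch_map_def image_subset_iff)
  have "f (diff A (x n) + (\<Sum>i=1..<n. x i * x (n - i))) = 0" if "n \<ge> 1" for n
    using assms(2) that f.zero by (simp add: TS_def)
  then show ?thesis
    using assms(2) by (auto simp: TS_def * f.zero f.add f.sum)
qed

lemma hirsch_map_mu:
  assumes "hirsch_map A B f"
  shows "f \<circ> mu A x y = mu B (f \<circ> x) (f \<circ> y)"
proof
  fix k
  interpret f: additive f using assms by (simp add: hirsch_map_def)
  have "f (hop A as bs) = hop B (map f as) (map f bs)" if "as \<noteq> [] \<or> bs \<noteq> []" for as bs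
    using assms that by (auto simp: hirsch_map_def)
  then show "(f \<circ> mu A x y) k = mu B (f \<circ> x) (f \<circ> y) k"
    unfolding mu_def comp_apply f.sum by (intro sum.cong refl) (auto simp: mu_index_def comp_def)
qed

theorem theorem4:
  fixes A :: "'a::ring hirsch_alg" and B :: "'b::ring hirsch_alg"
  assumes "hirsch_algebra A"
  shows
    "(\<forall>x \<in> TS A. \<forall>y \<in> TS A. mu A x y \<in> TS A) \<and>
     (\<lambda>_. 0) \<in> TS A \<and>
     (\<forall>x \<in> TS A. mu A (\<lambda>_. 0) x = x \<and> mu A x (\<lambda>_. 0) = x) \<and>
     (\<forall>f. hirsch_algebra B \<and> hirsch_map A B f \<longrightarrow>
        (\<forall>x \<in> TS A. f \<circ> x \<in> TS B) \<and>
        (\<forall>x \<in> TS A. \<forall>y \<in> TS A. f \<circ> mu A x y = mu B (f \<circ> x) (f \<circ> y))) \<and>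
     (\<exists>hmu. (\<forall>X \<in> ts A. \<forall>Y \<in> ts A. hmu X Y \<in> ts A) \<and>
        (\<forall>x \<in> TS A. \<forall>y \<in> TS A. hmu (ts_class A x) (ts_class A y) = ts_class A (mu A x y)))"
proof -
  interpret hirsch_algebra A by (rule assms)
  \<comment> \<open>For homotopy classes \<open>X\<close> and \<open>Y\<close>, all sets in this
    union coincide by the congruence shown next, so the union is again a single class.\<close>
  define hmu where "hmu X Y = (\<Union>x\<in>X. \<Union>y\<in>Y. ts_class A (mu A x y))" for X Y
  have "congruent2 (homotopy_rel A) (homotopy_rel A) (\<lambda>x y. ts_class A (mu A x y))"
    unfolding congruent2_def ts_class_def
    by (auto intro!: equiv_class_eq[OF equiv_homotopy_rel] mu_respects_homotopy)
  then have hmu: "hmu (ts_class A x) (ts_class A y) = ts_class A (mu A x y)"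
    if "x \<in> TS A" "y \<in> TS A" for x y
    unfolding hmu_def using that
      UN_equiv_class2[OF equiv_homotopy_rel equiv_homotopy_rel]
    by (simp add: ts_class_def)
  have "hmu X Y \<in> ts A" if XY: "X \<in> ts A" "Y \<in> ts A" for X Y
  proof -
    obtain x y where "x \<in> TS A" "X = ts_class A x" "y \<in> TS A" "Y = ts_class A y"
      using XY by (auto simp: ts_def ts_class_def quotient_def)
    then show ?thesis
      using hmu mu_in_TS by (auto simp: ts_def ts_class_def quotient_def)
  qed
  moreover have "x 0 = 0" if "x \<in> TS A" for x
    using that by (simp add: TS_def)
  ultimately show ?thesis
    by (intro conjI ballI allI impI exI[of _ hmu])
      (auto simp: hmu mu_in_TS zero_in_TS mu_zero_left mu_zero_right hirsch_map_mu
        intro: hirsch_map_TS)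
qed

end
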